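(* Fix a finite graph $\mathcal{G}$ and two sets of Jacobi parameters on it, $\{a_\alpha,b_j\}_{\alpha\in E(\mathcal{G}),\,j\in V(\mathcal{G})}$ and $\{\tilde a_\alpha,\tilde b_j\}_{\alpha\in E(\mathcal{G}),\,j\in V(\mathcal{G})}$, with Jacobi matrices $J=J(a,b)$ and $\tilde J=J(\tilde a,\tilde b)$ on $\ell^2(V(\mathcal{G}))$. Let $\psi$ and $\tilde\psi$ be the strictly positive solutions of $J\psi=\sigma\psi$ and $\tilde J\tilde\psi=\tilde\sigma\tilde\psi$, where $\sigma=\sigma(a,b)$ and $\tilde\sigma=\sigma(\tilde a,\tilde b)$ are the largest eigenvalues of $J$ and $\tilde J$. Set $$S=\sup_{\alpha=(i,j)\in E(\mathcal{G})}\left[\frac{a_\alpha}{\tilde a_\alpha}\frac{\psi_i\psi_j}{\tilde\psi_i\tilde\psi_j}\right],\qquad \tilde S=\sup_{\alpha=(i,j)\in E(\mathcal{G})}\left[\frac{\tilde a_\alpha}{a_\alpha}\frac{\tilde\psi_i\tilde\psi_j}{\psi_i\psi_j}\right],$$ $$I=\inf_{i\in V(\mathcal{G})}\frac{\psi_i^2}{\tilde\psi_i^2},\qquad \tilde I=\inf_{i\in V(\mathcal{G})}\frac{\tilde\psi_i^2}{\psi_i^2}.$$ Then $$\frac{\tilde I}{\tilde S}\,G(\tilde a,\tilde b)\le G(a,b)\le\frac{S}{I}\,G(\tilde a,\tilde b).$$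
   Context: Graphs: $\mathcal{G}$ is a finite, connected, leafless graph (every vertex has degree at least $2$) with vertex set $V(\mathcal{G})$ and edge set $E(\mathcal{G})$; multiple edges and self-loops are allowed, a self-loop counting twice in the degree. The notation $\alpha=(i,j)$ means that $i,j$ are the two ends of the edge $\alpha$. Jacobi parameters on $\mathcal{G}$ are numbers $a_\alpha>0$ for each edge $\alpha\in E(\mathcal{G})$ and $b_j\in\mathbb{R}$ for each $j\in V(\mathcal{G})$. The associated Jacobi matrix $J=J(a,b)$ acts on $\ell^2(V(\mathcal{G}))$ by $$(Ju)_j=b_ju_j+\sum_{\alpha}a_\alpha u_k,$$ the sum being over edges $\alpha$ with one end $j$ and other end $k$ (with multiplicity for multiple edges; a self-loop at $j$ contributes twice). Let $\mathcal{T}$ be the universal cover of $\mathcal{G}$, an infinite leafless tree, with covering map $\pi:\mathcal{T}\to\mathcal{G}$. The parameters lift to $\mathcal{T}$ by assigning to each edge (vertex) of $\mathcal{T}$ the value of $a$ (of $b$) at its image under $\pi$. The bounded self-adjoint operator $H=H(a,b)$ on $\ell^2(V(\mathcal{T}))$ given by the same formula with the lifted parameters is the induced periodic Jacobi matrix. By the Perron--Frobenius theorem, $J(a,b)$ has a simple largest eigenvalue $\sigma(a,b)$ with a strictly positive eigenvector, unique up to normalization (normalized to have $\ell^2$ norm $1$). Let $\Sigma(a,b)$ be the supremum of the spectrum of $H(a,b)$. The gap is $G(a,b)=\sigma(a,b)-\Sigma(a,b)$. *)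

theory Defs
  imports "HOL-Analysis.Analysis" "Graph_Theory.Graph_Theory"
begin

section \<open>Multigraphs and universal covers\<close>

text \<open>
  An undirected multigraph with self-loops is a \<^locale>\<open>bidirected_digraph\<close>: every edge with ends
  $i, j$ is represented by two arcs, one from $i$ to $j$ and one from $j$ to $i$, exchanged by the
  fixed-point-free involution \<open>arev\<close>. A self-loop is represented by two distinct arcs from its
  vertex to itself, so it counts twice in \<^const>\<open>out_degree\<close>, as well as in sums over
  \<^const>\<open>out_arcs\<close>. \<open>Digraph_Component.connected\<close> includes nonemptiness.
\<close>

locale finite_leafless_graph = bidirected_digraph G arev + fin_digraph G
  for G :: "('v, 'e) pre_digraph" and arev :: "'e \<Rightarrow> 'e" +
  assumes graph_connected: "Digraph_Component.connected G"
    and leafless: "\<And>v. v \<in> verts G \<Longrightarrow> 2 \<le> out_degree G v"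

text \<open>
  The library notion of cycle is directed and admits the walk that traverses an edge and
  immediately returns along it. A cycle of the undirected graph uses no edge in both directions.
  (The library notion of tree forgets multiple edges.)
\<close>

definition tree_graph :: "('w, 'f) pre_digraph \<Rightarrow> ('f \<Rightarrow> 'f) \<Rightarrow> bool" where
  "tree_graph T arev \<longleftrightarrow>
     bidirected_digraph T arev \<and> Digraph_Component.connected T \<and>
     \<not> (\<exists>p. pre_digraph.cycle T p \<and> (\<forall>e \<in> set p. arev e \<notin> set p))"

text \<open>
  A covering map consists of a vertex map \<open>p\<close> and an arc map \<open>q\<close>. It is a surjective graph
  morphism that maps the arcs leaving any vertex bijectively onto the arcs leaving its image.
\<close>

definition covering_map ::
  "('w, 'f) pre_digraph \<Rightarrow> ('f \<Rightarrow> 'f) \<Rightarrow> ('v, 'e) pre_digraph \<Rightarrow> ('e \<Rightarrow> 'e) \<Rightarrow>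
   ('w \<Rightarrow> 'v) \<Rightarrow> ('f \<Rightarrow> 'e) \<Rightarrow> bool" where
  "covering_map T arevT G arevG p q \<longleftrightarrow>
     p ` verts T = verts G \<and>
     (\<forall>e \<in> arcs T. q e \<in> arcs G \<and> tail G (q e) = p (tail T e) \<and> head G (q e) = p (head T e)
                    \<and> q (arevT e) = arevG (q e)) \<and>
     (\<forall>x \<in> verts T. bij_betw q (out_arcs T x) (out_arcs G (p x)))"

definition universal_cover ::
  "('w, 'f) pre_digraph \<Rightarrow> ('f \<Rightarrow> 'f) \<Rightarrow> ('v, 'e) pre_digraph \<Rightarrow> ('e \<Rightarrow> 'e) \<Rightarrow>
   ('w \<Rightarrow> 'v) \<Rightarrow> ('f \<Rightarrow> 'e) \<Rightarrow> bool" where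
  "universal_cover T arevT G arevG p q \<longleftrightarrow>
     tree_graph T arevT \<and> covering_map T arevT G arevG p q"

section \<open>Square-summable functions and spectrum\<close>

text \<open>
  $\ell^2(X)$ is the set of complex square-summable functions on \<open>X\<close>, extended by zero outside \<open>X\<close>.
\<close>

definition ell2 :: "'x set \<Rightarrow> ('x \<Rightarrow> complex) set" where
  "ell2 X = {u. (\<forall>x. x \<notin> X \<longrightarrow> u x = 0) \<and> (\<lambda>x. (cmod (u x))\<^sup>2) summable_on X}"

definition ell2_norm :: "'x set \<Rightarrow> ('x \<Rightarrow> complex) \<Rightarrow> real" where
  "ell2_norm X u = sqrt (infsum (\<lambda>x. (cmod (u x))\<^sup>2) X)"

definition bounded_operator_on ::
  "'x set \<Rightarrow> (('x \<Rightarrow> complex) \<Rightarrow> ('x \<Rightarrow> complex)) \<Rightarrow> bool" where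
  "bounded_operator_on X A \<longleftrightarrow>
     (\<forall>u \<in> ell2 X. A u \<in> ell2 X) \<and>
     (\<forall>u \<in> ell2 X. \<forall>v \<in> ell2 X. A (\<lambda>x. u x + v x) = (\<lambda>x. A u x + A v x)) \<and>
     (\<forall>c. \<forall>u \<in> ell2 X. A (\<lambda>x. c * u x) = (\<lambda>x. c * A u x)) \<and>
     (\<exists>C. \<forall>u \<in> ell2 X. ell2_norm X (A u) \<le> C * ell2_norm X u)"

definition spectrum_on ::
  "'x set \<Rightarrow> (('x \<Rightarrow> complex) \<Rightarrow> ('x \<Rightarrow> complex)) \<Rightarrow> complex set" where
  "spectrum_on X A =
     {z. \<not> (\<exists>R. bounded_operator_on X R \<and>
               (\<forall>u \<in> ell2 X. R (\<lambda>x. A u x - z * u x) = u) \<and>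
               (\<forall>u \<in> ell2 X. (\<lambda>x. A (R u) x - z * R u x) = u))}"

section \<open>Jacobi matrices\<close>

text \<open>Edge parameters are functions on arcs that take the same value on both arcs of an edge.\<close>

definition jacobi_parameters ::
  "('v, 'e) pre_digraph \<Rightarrow> ('e \<Rightarrow> 'e) \<Rightarrow> ('e \<Rightarrow> real) \<Rightarrow> ('v \<Rightarrow> real) \<Rightarrow> bool" where
  "jacobi_parameters G arev a b \<longleftrightarrow> (\<forall>e \<in> arcs G. 0 < a e \<and> a (arev e) = a e)"

definition jacobi_op ::
  "('v, 'e) pre_digraph \<Rightarrow> ('e \<Rightarrow> real) \<Rightarrow> ('v \<Rightarrow> real) \<Rightarrow> ('v \<Rightarrow> 'c::real_vector) \<Rightarrow> ('v \<Rightarrow> 'c)" where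
  "jacobi_op G a b u =
     (\<lambda>j. if j \<in> verts G
          then b j *\<^sub>R u j + (\<Sum>e \<in> out_arcs G j. a e *\<^sub>R u (head G e)) else 0)"

definition is_eigenvalue ::
  "('v, 'e) pre_digraph \<Rightarrow> ('e \<Rightarrow> real) \<Rightarrow> ('v \<Rightarrow> real) \<Rightarrow> real \<Rightarrow> bool" where
  "is_eigenvalue G a b l \<longleftrightarrow>
     (\<exists>u \<in> ell2 (verts G). u \<noteq> (\<lambda>_. 0) \<and> jacobi_op G a b u = (\<lambda>j. l *\<^sub>R u j))"

definition largest_eigenvalue ::
  "('v, 'e) pre_digraph \<Rightarrow> ('e \<Rightarrow> real) \<Rightarrow> ('v \<Rightarrow> real) \<Rightarrow> real" where
  "largest_eigenvalue G a b = (GREATEST l. is_eigenvalue G a b l)"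

text \<open>The values of \<open>\<psi>\<close> outside the vertex set are irrelevant.\<close>

definition perron_eigenvector ::
  "('v, 'e) pre_digraph \<Rightarrow> ('e \<Rightarrow> real) \<Rightarrow> ('v \<Rightarrow> real) \<Rightarrow> ('v \<Rightarrow> real) \<Rightarrow> bool" where
  "perron_eigenvector G a b \<psi> \<longleftrightarrow>
     (\<forall>j \<in> verts G. 0 < \<psi> j) \<and> (\<Sum>j \<in> verts G. (\<psi> j)\<^sup>2) = 1 \<and>
     (\<forall>j \<in> verts G. jacobi_op G a b \<psi> j = largest_eigenvalue G a b * \<psi> j)"

definition periodic_jacobi ::
  "('w, 'f) pre_digraph \<Rightarrow> ('w \<Rightarrow> 'v) \<Rightarrow> ('f \<Rightarrow> 'e) \<Rightarrow> ('e \<Rightarrow> real) \<Rightarrow> ('v \<Rightarrow> real) \<Rightarrow>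
   ('w \<Rightarrow> complex) \<Rightarrow> ('w \<Rightarrow> complex)" where
  "periodic_jacobi T p q a b = jacobi_op T (a \<circ> q) (b \<circ> p)"

text \<open>The operator is bounded and self-adjoint, so its spectrum is real.\<close>

definition spectral_top ::
  "('w, 'f) pre_digraph \<Rightarrow> ('w \<Rightarrow> 'v) \<Rightarrow> ('f \<Rightarrow> 'e) \<Rightarrow> ('e \<Rightarrow> real) \<Rightarrow> ('v \<Rightarrow> real) \<Rightarrow> real" where
  "spectral_top T p q a b =
     Sup {x. complex_of_real x \<in> spectrum_on (verts T) (periodic_jacobi T p q a b)}"

definition gap ::
  "('v, 'e) pre_digraph \<Rightarrow> ('w, 'f) pre_digraph \<Rightarrow> ('w \<Rightarrow> 'v) \<Rightarrow> ('f \<Rightarrow> 'e) \<Rightarrow>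
   ('e \<Rightarrow> real) \<Rightarrow> ('v \<Rightarrow> real) \<Rightarrow> real" where
  "gap G T p q a b = largest_eigenvalue G a b - spectral_top T p q a b"

end

theory Submission
  imports Defs
begin

text \<open>
  The Perron eigenvector $\psi$ lifts to a positive, bounded, $\pi$-periodic function on the tree with
  $H(\psi \circ \pi) = \sigma \, (\psi \circ \pi)$. Substituting $u = (\psi \circ \pi) f$ gives
  $\langle u, (\sigma - H) u \rangle = \sum_{\alpha = (i, j)} a_\alpha \psi_i \psi_j |f_i - f_j|^2$, and since
  $\Sigma$ is the top of the numerical range, the gap is the infimum of the quotient of this
  Dirichlet form by $\sum_i \psi_i^2 |f_i|^2$. Replacing $(a, \psi)$ by $(\tilde a, \tilde\psi)$ with $f$ fixed
  changes the numerator by a factor of at most $S$ and the denominator by a factor of at least $I$.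
\<close>

text \<open>The gap is defined by points without a bounded two-sided inverse, whereas the comparison
  needs a variational description. The bridge is the equality of the top of the spectrum with the
  top of the quadratic form. Both halves of it rest on one estimate: a symmetric \<open>P\<close>
  whose form lies between 0 and \<open>D |u|^2\<close> satisfies
  \<open>|P u|^2 <= D <P u, u>\<close>. Above the top this turns a form bound into a norm bound, so
  that a Neumann series inverts; at the top a bounded inverse would leave room to lower the
  supremum. On an infinite tree the lifted eigenvector is not square-summable and can act only as a
  multiplier. Finiteness of the graph keeps it between two positive constants, so multiplication by
  it maps \<open>ell2\<close> onto itself, and both parameter sets can be tested on the same
  functions. The lower estimate is the upper one with the parameter sets exchanged.\<close>

section \<open>Symmetric operators on $\ell^2$\<close>

text \<open>The real part of the Hermitian inner product: it is all that the variational arguments use,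
  and it keeps the quadratic forms real-valued.\<close>

definition ell2_inner :: "'x set \<Rightarrow> ('x \<Rightarrow> complex) \<Rightarrow> ('x \<Rightarrow> complex) \<Rightarrow> real" where
  "ell2_inner X u v = (\<Sum>\<^sub>\<infinity>x\<in>X. u x \<bullet> v x)"

definition symmetric_operator_on ::
  "'x set \<Rightarrow> (('x \<Rightarrow> complex) \<Rightarrow> ('x \<Rightarrow> complex)) \<Rightarrow> bool" where
  "symmetric_operator_on X A \<longleftrightarrow>
     (\<forall>u \<in> ell2 X. \<forall>v \<in> ell2 X. ell2_inner X (A u) v = ell2_inner X u (A v))"

section \<open>Elementary properties of square-summable functions\<close>

lemma ell2_summable: "u \<in> ell2 X \<Longrightarrow> (\<lambda>x. (cmod (u x))\<^sup>2) summable_on X"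
  by (simp add: ell2_def)

lemma abs_inner_le: "\<bar>(x::'a::real_inner) \<bullet> y\<bar> \<le> ((norm x)\<^sup>2 + (norm y)\<^sup>2) / 2"
proof -
  have "\<bar>x \<bullet> y\<bar> \<le> norm x * norm y" by (rule Cauchy_Schwarz_ineq2)
  also have "\<dots> \<le> ((norm x)\<^sup>2 + (norm y)\<^sup>2) / 2"
    using sum_squares_bound[of "norm x" "norm y"] by simp
  finally show ?thesis .
qed

lemma ell2_inner_summable:
  assumes "u \<in> ell2 X" "v \<in> ell2 X"
  shows "(\<lambda>x. u x \<bullet> v x) summable_on X"
proof -
  have "(\<lambda>x. ((cmod (u x))\<^sup>2 + (cmod (v x))\<^sup>2) * (1 / 2)) summable_on X"
    by (intro summable_on_cmult_left summable_on_add ell2_summable assms)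
  then have "(\<lambda>x. norm (u x \<bullet> v x)) summable_on X"
    by (rule Infinite_Sum.abs_summable_on_comparison_test') (use abs_inner_le in auto)
  then show ?thesis by (rule abs_summable_summable)
qed

lemma ell2_add:
  assumes "u \<in> ell2 X" "v \<in> ell2 X"
  shows "(\<lambda>x. u x + v x) \<in> ell2 X"
proof -
  have "(\<lambda>x. 2 * (cmod (u x))\<^sup>2 + 2 * (cmod (v x))\<^sup>2) summable_on X"
    by (intro summable_on_cmult_right summable_on_add ell2_summable assms)
  then have "(\<lambda>x. (cmod (u x + v x))\<^sup>2) summable_on X"
  proof (rule summable_on_comparison_test)
    fix x
    have "(cmod (u x + v x))\<^sup>2 \<le> (cmod (u x) + cmod (v x))\<^sup>2"
      by (intro power_mono norm_triangle_ineq) auto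
    also have "\<dots> \<le> 2 * (cmod (u x))\<^sup>2 + 2 * (cmod (v x))\<^sup>2"
      using sum_squares_bound[of "cmod (u x)" "cmod (v x)"] by (simp add: power2_sum)
    finally show "(cmod (u x + v x))\<^sup>2 \<le> 2 * (cmod (u x))\<^sup>2 + 2 * (cmod (v x))\<^sup>2" .
  qed auto
  then show ?thesis using assms by (simp add: ell2_def)
qed

lemma ell2_cmult: "u \<in> ell2 X \<Longrightarrow> (\<lambda>x. c * u x) \<in> ell2 X"
  by (auto simp: ell2_def norm_mult power_mult_distrib intro: summable_on_cmult_right)

lemma ell2_inner_commute: "ell2_inner X u v = ell2_inner X v u"
  by (simp add: ell2_inner_def inner_commute)

lemma ell2_inner_add_left:
  assumes "u \<in> ell2 X" "v \<in> ell2 X" "w \<in> ell2 X"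
  shows "ell2_inner X (\<lambda>x. u x + v x) w = ell2_inner X u w + ell2_inner X v w"
  by (simp add: ell2_inner_def inner_add_left infsum_add ell2_inner_summable assms)

lemma ell2_inner_cmult_left: "ell2_inner X (\<lambda>x. of_real c * u x) w = c * ell2_inner X u w"
  by (simp add: ell2_inner_def infsum_cmult_right' flip: scaleR_conv_of_real)

lemma ell2_inner_self: "ell2_inner X u u = (\<Sum>\<^sub>\<infinity>x\<in>X. (cmod (u x))\<^sup>2)"
  by (simp add: ell2_inner_def power2_norm_eq_inner)

lemma ell2_inner_self_nonneg: "0 \<le> ell2_inner X u u"
  by (simp add: ell2_inner_self infsum_nonneg)

lemma ell2_norm_eq: "ell2_norm X u = sqrt (ell2_inner X u u)"
  by (simp add: ell2_norm_def ell2_inner_self)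

lemma ell2_norm_nonneg: "0 \<le> ell2_norm X u"
  by (simp add: ell2_norm_eq ell2_inner_self_nonneg)

lemma ell2_norm_square: "(ell2_norm X u)\<^sup>2 = ell2_inner X u u"
  by (simp add: ell2_norm_eq ell2_inner_self_nonneg)

text \<open>One term of the series is at most the whole sum. Through this bound norm estimates
  control the Neumann series at each point.\<close>

lemma cmod_le_ell2_norm:
  assumes "u \<in> ell2 X"
  shows "cmod (u x) \<le> ell2_norm X u"
proof (cases "x \<in> X")
  case True
  have "(cmod (u x))\<^sup>2 \<le> ell2_inner X u u"
    using finite_sum_le_infsum[OF ell2_summable[OF assms], of "{x}"] True
    by (simp add: ell2_inner_self)
  then show ?thesis by (simp add: ell2_norm_eq real_le_rsqrt)
next
  case False
  then show ?thesis using assms ell2_norm_nonneg by (simp add: ell2_def)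
qed

lemma ell2_norm_eq_0_iff:
  assumes "u \<in> ell2 X"
  shows "ell2_norm X u = 0 \<longleftrightarrow> u = (\<lambda>_. 0)"
proof
  assume "ell2_norm X u = 0"
  then show "u = (\<lambda>_. 0)" using cmod_le_ell2_norm[OF assms] by (auto simp: fun_eq_iff)
qed (simp add: ell2_norm_def)

text \<open>Supplies a vector of norm 1, so that the supremum of the form over unit vectors is taken
  over a nonempty set.\<close>

lemma ell2_unit_vector:
  assumes "x \<in> X"
  shows "(\<lambda>y. if y = x then 1 else 0) \<in> ell2 X" (is "?d \<in> _")
    and "ell2_inner X (\<lambda>y. if y = x then 1 else 0) (\<lambda>y. if y = x then 1 else 0) = 1"
proof -
  have "((\<lambda>y. (cmod (?d y))\<^sup>2) has_sum 1) {x}"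
    using has_sum_finite[of "{x}" "\<lambda>y. (cmod (?d y))\<^sup>2"] by simp
  then have *: "((\<lambda>y. (cmod (?d y))\<^sup>2) has_sum 1) X"
    by (rule iffD1[OF has_sum_cong_neutral, rotated 3]) (use assms in auto)
  then show "?d \<in> ell2 X" using assms by (auto simp: ell2_def intro: has_sum_imp_summable)
  show "ell2_inner X ?d ?d = 1" using * by (simp only: ell2_inner_self infsumI)
qed

text \<open>The terms are nonnegative, so summability and the size of the sum are both decided on
  finite subsets. This lets facts about \<open>L2_set\<close> and pointwise limits pass to
  \<open>ell2\<close>.\<close>

lemma ell2_norm_bounds:
  assumes u0: "\<And>x. x \<notin> X \<Longrightarrow> u x = 0" and "0 \<le> C"
    and L2: "\<And>F. finite F \<Longrightarrow> F \<subseteq> X \<Longrightarrow> L2_set (\<lambda>x. cmod (u x)) F \<le> C"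
  shows "u \<in> ell2 X" and "ell2_norm X u \<le> C"
proof -
  have bd: "(\<Sum>x\<in>F. (cmod (u x))\<^sup>2) \<le> C\<^sup>2" if "finite F" "F \<subseteq> X" for F
    using L2[OF that] unfolding L2_set_def by (rule sqrt_le_D)
  have s: "(\<lambda>x. (cmod (u x))\<^sup>2) summable_on X"
    by (rule nonneg_bdd_above_summable_on) (use bd in \<open>auto intro!: bdd_aboveI2\<close>)
  then show "u \<in> ell2 X" using u0 by (simp add: ell2_def)
  have "ell2_inner X u u \<le> C\<^sup>2"
    unfolding ell2_inner_self by (rule infsum_le_finite_sums[OF s bd])
  then show "ell2_norm X u \<le> C" using \<open>0 \<le> C\<close> by (simp add: ell2_norm_eq real_le_lsqrt)
qed

lemma L2_set_le_ell2_norm: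
  assumes "u \<in> ell2 X" "finite F" "F \<subseteq> X"
  shows "L2_set (\<lambda>x. cmod (u x)) F \<le> ell2_norm X u"
  unfolding L2_set_def ell2_norm_def
  by (intro real_sqrt_le_mono finite_sum_le_infsum ell2_summable assms) auto

section \<open>Bounded operators and positive forms\<close>

lemma bounded_operatorD:
  assumes "bounded_operator_on X A"
  shows "u \<in> ell2 X \<Longrightarrow> A u \<in> ell2 X"
    and "u \<in> ell2 X \<Longrightarrow> v \<in> ell2 X \<Longrightarrow> A (\<lambda>x. u x + v x) = (\<lambda>x. A u x + A v x)"
    and "u \<in> ell2 X \<Longrightarrow> A (\<lambda>x. c * u x) = (\<lambda>x. c * A u x)"
  using assms by (auto simp: bounded_operator_on_def)

text \<open>The definition puts no sign on the constant; \<open>max C 0\<close> makes it safe in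
  monotonicity arguments.\<close>

lemma bounded_operator_boundE:
  assumes "bounded_operator_on X A"
  obtains C where "0 \<le> C" "\<And>u. u \<in> ell2 X \<Longrightarrow> ell2_norm X (A u) \<le> C * ell2_norm X u"
proof -
  obtain C where C: "\<forall>u \<in> ell2 X. ell2_norm X (A u) \<le> C * ell2_norm X u"
    using assms by (auto simp: bounded_operator_on_def)
  show thesis
  proof (rule that[of "max C 0"])
    fix u assume "u \<in> ell2 X"
    then have "ell2_norm X (A u) \<le> C * ell2_norm X u" using C by blast
    also have "\<dots> \<le> max C 0 * ell2_norm X u"
      by (intro mult_right_mono ell2_norm_nonneg) simp
    finally show "ell2_norm X (A u) \<le> max C 0 * ell2_norm X u" .
  qed simp
qed

lemma ell2_norm_add_le:
  assumes "u \<in> ell2 X" "v \<in> ell2 X"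
  shows "ell2_norm X (\<lambda>x. u x + v x) \<le> ell2_norm X u + ell2_norm X v"
proof (rule ell2_norm_bounds(2))
  fix F assume F: "finite F" "F \<subseteq> X"
  have "L2_set (\<lambda>x. cmod (u x + v x)) F \<le> L2_set (\<lambda>x. cmod (u x) + cmod (v x)) F"
    by (intro L2_set_mono norm_triangle_ineq) auto
  also have "\<dots> \<le> L2_set (\<lambda>x. cmod (u x)) F + L2_set (\<lambda>x. cmod (v x)) F"
    by (rule L2_set_triangle_ineq)
  also have "\<dots> \<le> ell2_norm X u + ell2_norm X v"
    using F by (intro add_mono L2_set_le_ell2_norm assms)
  finally show "L2_set (\<lambda>x. cmod (u x + v x)) F \<le> ell2_norm X u + ell2_norm X v" .
qed (use assms in \<open>auto simp: ell2_def ell2_norm_nonneg\<close>)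

lemma ell2_norm_cmult: "ell2_norm X (\<lambda>x. c * u x) = cmod c * ell2_norm X u"
  by (simp add: ell2_norm_def norm_mult power_mult_distrib infsum_cmult_right' real_sqrt_mult)

lemma bounded_operator_affine:
  assumes A: "bounded_operator_on X A"
  shows "bounded_operator_on X (\<lambda>u x. s * u x + t * A u x)"
proof -
  obtain C where C: "0 \<le> C" "\<And>u. u \<in> ell2 X \<Longrightarrow> ell2_norm X (A u) \<le> C * ell2_norm X u"
    using bounded_operator_boundE[OF A] by metis
  have "ell2_norm X (\<lambda>x. s * u x + t * A u x) \<le> (cmod s + cmod t * C) * ell2_norm X u"
    if u: "u \<in> ell2 X" for u
  proof -
    have "ell2_norm X (\<lambda>x. s * u x + t * A u x)
        \<le> ell2_norm X (\<lambda>x. s * u x) + ell2_norm X (\<lambda>x. t * A u x)"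
      by (intro ell2_norm_add_le ell2_cmult u bounded_operatorD(1)[OF A])
    also have "\<dots> = cmod s * ell2_norm X u + cmod t * ell2_norm X (A u)"
      by (simp add: ell2_norm_cmult)
    also have "\<dots> \<le> cmod s * ell2_norm X u + cmod t * (C * ell2_norm X u)"
      by (intro add_left_mono mult_left_mono C u) auto
    finally show ?thesis by (simp add: algebra_simps)
  qed
  then have "\<exists>C. \<forall>u \<in> ell2 X. ell2_norm X (\<lambda>x. s * u x + t * A u x) \<le> C * ell2_norm X u"
    by blast
  then show ?thesis
    unfolding bounded_operator_on_def
    by (simp add: bounded_operatorD[OF A] ell2_add ell2_cmult algebra_simps)
qed

lemma ell2_inner_affine_left:
  assumes "u \<in> ell2 X" "v \<in> ell2 X" "w \<in> ell2 X"
  shows "ell2_inner X (\<lambda>x. of_real s * u x + of_real t * v x) w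
    = s * ell2_inner X u w + t * ell2_inner X v w"
  by (simp add: ell2_inner_add_left ell2_inner_cmult_left ell2_cmult assms)

text \<open>The coefficients are real because multiplication by a non-real scalar is in general not
  symmetric for the real part of the inner product.\<close>

lemma symmetric_operator_affine:
  assumes A: "bounded_operator_on X A" "symmetric_operator_on X A"
  shows "symmetric_operator_on X (\<lambda>u x. of_real s * u x + of_real t * A u x)"
  unfolding symmetric_operator_on_def
proof (intro ballI)
  fix u v assume u: "u \<in> ell2 X" and v: "v \<in> ell2 X"
  note Av = bounded_operatorD(1)[OF A(1) u] bounded_operatorD(1)[OF A(1) v]
  have "ell2_inner X (A u) v = ell2_inner X (A v) u"
    using A(2) u v by (simp add: symmetric_operator_on_def ell2_inner_commute)
  then show "ell2_inner X (\<lambda>x. of_real s * u x + of_real t * A u x) v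
    = ell2_inner X u (\<lambda>x. of_real s * v x + of_real t * A v x)"
    by (simp add: ell2_inner_affine_left u v Av
        ell2_inner_commute[of X u "\<lambda>x. of_real s * v x + of_real t * A v x"]
        ell2_inner_commute[of X v u])
qed

text \<open>Evaluate the nonnegative form at $u - D^{-1} P u$.\<close>

lemma positive_operator_bound:
  assumes P: "bounded_operator_on X P" "symmetric_operator_on X P"
    and ge: "\<And>w. w \<in> ell2 X \<Longrightarrow> 0 \<le> ell2_inner X (P w) w"
    and le: "\<And>w. w \<in> ell2 X \<Longrightarrow> ell2_inner X (P w) w \<le> D * ell2_inner X w w"
    and "0 < D" and u: "u \<in> ell2 X"
  shows "ell2_inner X (P u) (P u) \<le> D * ell2_inner X (P u) u"
proof -
  define t where "t = - 1 / D"
  define w where "w = (\<lambda>x. of_real 1 * u x + of_real t * P u x)"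
  have Pu: "P u \<in> ell2 X" and PPu: "P (P u) \<in> ell2 X"
    using P(1) u by (auto intro: bounded_operatorD(1))
  have w: "w \<in> ell2 X"
    unfolding w_def by (intro ell2_add ell2_cmult u Pu)
  have Pw: "P w = (\<lambda>x. of_real 1 * P u x + of_real t * P (P u) x)"
    unfolding w_def by (simp add: bounded_operatorD[OF P(1)] ell2_cmult u Pu)
  have "ell2_inner X (P w) w = ell2_inner X w (P u) + t * ell2_inner X w (P (P u))"
    unfolding Pw ell2_inner_affine_left[OF Pu PPu w] by (simp add: ell2_inner_commute)
  also have "\<dots> = ell2_inner X u (P u) + t * ell2_inner X (P u) (P u)
     + t * (ell2_inner X u (P (P u)) + t * ell2_inner X (P u) (P (P u)))"
    unfolding w_def ell2_inner_affine_left[OF u Pu Pu] ell2_inner_affine_left[OF u Pu PPu] by simp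
  also have "ell2_inner X u (P (P u)) = ell2_inner X (P u) (P u)"
    using P(2) u Pu by (simp add: symmetric_operator_on_def)
  finally have "0 \<le> ell2_inner X (P u) u + 2 * t * ell2_inner X (P u) (P u)
      + t\<^sup>2 * ell2_inner X (P (P u)) (P u)"
    using ge[OF w]
    by (simp add: ell2_inner_commute[of X u] ell2_inner_commute[of X "P u" "P (P u)"]
        algebra_simps power2_eq_square)
  \<comment> \<open>The upper form bound is applied at \<open>P u\<close>. The resulting quadratic
    polynomial in \<open>t\<close> is minimal at \<open>- 1 / D\<close>, which is where the choice
    of \<open>t\<close> comes from.\<close>
  also have "\<dots> \<le> ell2_inner X (P u) u + 2 * t * ell2_inner X (P u) (P u)
      + t\<^sup>2 * (D * ell2_inner X (P u) (P u))"
    by (intro add_left_mono mult_left_mono le Pu) auto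
  also have "\<dots> = ell2_inner X (P u) u - ell2_inner X (P u) (P u) / D"
    using \<open>0 < D\<close> by (simp add: t_def field_simps power2_eq_square)
  finally show ?thesis using \<open>0 < D\<close> by (simp add: field_simps)
qed

section \<open>Inversion by a Neumann series\<close>

lemma L2_set_sum_le:
  "L2_set (\<lambda>x. cmod (\<Sum>k<n. g k x)) F \<le> (\<Sum>k<n. L2_set (\<lambda>x. cmod (g k x)) F)"
  for n :: nat
proof (induction n)
  case (Suc n)
  have "L2_set (\<lambda>x. cmod (\<Sum>k<Suc n. g k x)) F
      \<le> L2_set (\<lambda>x. cmod (\<Sum>k<n. g k x) + cmod (g n x)) F"
    by (intro L2_set_mono) (auto intro: norm_triangle_ineq)
  also have "\<dots> \<le> L2_set (\<lambda>x. cmod (\<Sum>k<n. g k x)) F + L2_set (\<lambda>x. cmod (g n x)) F"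
    by (rule L2_set_triangle_ineq)
  finally show ?case using Suc by simp
qed (simp add: L2_set_def)

text \<open>Since the series converges pointwise and its sum is bounded on every finite set, no appeal to
  the completeness of $\ell^2$ is needed.\<close>

lemma neumann_series:
  assumes K: "bounded_operator_on X K"
    and r: "0 \<le> r" "r < 1" and Kr: "\<And>u. u \<in> ell2 X \<Longrightarrow> ell2_norm X (K u) \<le> r * ell2_norm X u"
  obtains R where "bounded_operator_on X R"
    and "\<And>u. u \<in> ell2 X \<Longrightarrow> R (K u) = (\<lambda>x. R u x - u x)"
    and "\<And>u. u \<in> ell2 X \<Longrightarrow> K (R u) = (\<lambda>x. R u x - u x)"
proof -
  \<comment> \<open>The candidate for the inverse of \<open>1 - K\<close>; the two identities to be
    obtained say that it is a left and a right inverse.\<close>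
  define R where "R u = (\<lambda>x. \<Sum>k. (K ^^ k) u x)" for u
  have pow: "(K ^^ k) u \<in> ell2 X" if "u \<in> ell2 X" for k u
    by (induction k) (auto simp: that bounded_operatorD(1)[OF K])
  have pow_norm: "ell2_norm X ((K ^^ k) u) \<le> r ^ k * ell2_norm X u" if "u \<in> ell2 X" for k u
  proof (induction k)
    case (Suc k)
    have "ell2_norm X ((K ^^ Suc k) u) \<le> r * ell2_norm X ((K ^^ k) u)"
      using Kr[OF pow[OF that]] by simp
    also have "\<dots> \<le> r * (r ^ k * ell2_norm X u)"
      using r Suc by (intro mult_left_mono)
    finally show ?case by simp
  qed simp
  have geo: "summable (\<lambda>k. r ^ k * c)" for c
    using r by (intro summable_mult2 summable_geometric) auto
  have summ: "summable (\<lambda>k. (K ^^ k) u x)" if u: "u \<in> ell2 X" for u x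
    by (rule summable_comparison_test'[OF geo[of "ell2_norm X u"], of 0])
      (use cmod_le_ell2_norm[OF pow[OF u]] pow_norm[OF u] order_trans in blast)
  have lim: "(\<lambda>n. \<Sum>k<n. (K ^^ k) u x) \<longlonglongrightarrow> R u x" if u: "u \<in> ell2 X" for u x
    unfolding R_def by (rule summable_LIMSEQ[OF summ[OF u]])
  have bd: "R u \<in> ell2 X \<and> ell2_norm X (R u) \<le> (1 / (1 - r)) * ell2_norm X u"
    if u: "u \<in> ell2 X" for u
  proof (intro conjI; rule ell2_norm_bounds)
    show "R u x = 0" if "x \<notin> X" for x
      using pow[OF u] that by (simp add: R_def ell2_def)
    then show "R u x = 0" if "x \<notin> X" for x using that .
    show "0 \<le> 1 / (1 - r) * ell2_norm X u" using r ell2_norm_nonneg[of X u] by simp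
    then show "0 \<le> 1 / (1 - r) * ell2_norm X u" .
    fix F assume F: "finite F" "F \<subseteq> X"
    \<comment> \<open>On a fixed finite set the norm is a continuous function of finitely many
      values, so the uniform bound on the partial sums survives the pointwise limit.\<close>
    have "(\<lambda>n. L2_set (\<lambda>x. cmod (\<Sum>k<n. (K ^^ k) u x)) F) \<longlonglongrightarrow> L2_set (\<lambda>x. cmod (R u x)) F"
      unfolding L2_set_def by (intro tendsto_intros lim u)
    moreover have "L2_set (\<lambda>x. cmod (\<Sum>k<n. (K ^^ k) u x)) F \<le> 1 / (1 - r) * ell2_norm X u" for n
    proof -
      have "L2_set (\<lambda>x. cmod (\<Sum>k<n. (K ^^ k) u x)) F
          \<le> (\<Sum>k<n. L2_set (\<lambda>x. cmod ((K ^^ k) u x)) F)"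
        by (rule L2_set_sum_le)
      also have "\<dots> \<le> (\<Sum>k<n. r ^ k * ell2_norm X u)"
        by (intro sum_mono order_trans[OF L2_set_le_ell2_norm[OF pow[OF u] F] pow_norm[OF u]])
      also have "\<dots> \<le> (\<Sum>k. r ^ k * ell2_norm X u)"
        using r ell2_norm_nonneg[of X u] by (intro sum_le_suminf geo) auto
      also have "\<dots> = 1 / (1 - r) * ell2_norm X u"
        using r by (simp add: suminf_mult2[symmetric] summable_geometric suminf_geometric)
      finally show ?thesis .
    qed
    ultimately show "L2_set (\<lambda>x. cmod (R u x)) F \<le> 1 / (1 - r) * ell2_norm X u"
      by (intro LIMSEQ_le_const2) auto
    then show "L2_set (\<lambda>x. cmod (R u x)) F \<le> 1 / (1 - r) * ell2_norm X u" .
  qed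
  have pow_add: "(K ^^ k) (\<lambda>x. u x + v x) = (\<lambda>x. (K ^^ k) u x + (K ^^ k) v x)"
    if "u \<in> ell2 X" "v \<in> ell2 X" for u v k
    by (induction k) (auto simp: that bounded_operatorD[OF K] pow)
  have pow_cmult: "(K ^^ k) (\<lambda>x. c * u x) = (\<lambda>x. c * (K ^^ k) u x)" if "u \<in> ell2 X" for u c k
    by (induction k) (auto simp: that bounded_operatorD[OF K] pow)
  have R: "bounded_operator_on X R"
    unfolding bounded_operator_on_def
  proof (intro conjI ballI allI)
    fix u v assume "u \<in> ell2 X" "v \<in> ell2 X"
    then show "R (\<lambda>x. u x + v x) = (\<lambda>x. R u x + R v x)"
      by (simp add: R_def pow_add suminf_add summ)
  next
    fix u c assume "u \<in> ell2 X"
    then show "R (\<lambda>x. c * u x) = (\<lambda>x. c * R u x)"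
      by (simp add: R_def pow_cmult suminf_mult summ)
  qed (use bd in blast)+
  have RK: "R (K u) = (\<lambda>x. R u x - u x)" if u: "u \<in> ell2 X" for u
    using suminf_split_head[OF summ[OF u]]
    by (simp add: R_def fun_eq_iff funpow_Suc_right del: funpow.simps)
  have KR: "K (R u) = (\<lambda>x. R u x - u x)" if u: "u \<in> ell2 X" for u
  proof
    fix x
    \<comment> \<open>Pointwise convergence alone does not allow \<open>K\<close> to be applied term
      by term. Instead, the commutator of \<open>K\<close> and \<open>R\<close> is unchanged when
      \<open>u\<close> is replaced by \<open>K u\<close>; evaluated at the powers
      \<open>(K ^^ n) u\<close> it tends to 0, hence it vanishes.\<close>
    have defect: "K (R ((K ^^ n) u)) x - R ((K ^^ Suc n) u) x = K (R u) x - (R u x - u x)" for n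
    proof (induction n)
      case 0
      show ?case using RK[OF u] by simp
    next
      case (Suc n)
      define v where "v = (K ^^ n) u"
      have v: "v \<in> ell2 X" unfolding v_def by (rule pow[OF u])
      note Kv = bounded_operatorD(1)[OF K v]
      have Rv: "R v = (\<lambda>x. v x + R (K v) x)" "R (K v) = (\<lambda>x. K v x + R (K (K v)) x)"
        using RK[OF v] RK[OF Kv] by auto
      have "K (R v) x = K v x + K (R (K v)) x"
        by (subst Rv(1)) (simp add: bounded_operatorD[OF K] v bounded_operatorD[OF R] Kv)
      moreover have "R (K v) x = K v x + R (K (K v)) x"
        by (subst Rv(2)) simp
      ultimately show ?case using Suc by (simp flip: v_def)
    qed
    have to0: "(\<lambda>n. r ^ n * c) \<longlonglongrightarrow> 0" for c
      using geo[of c] by (rule summable_LIMSEQ_zero)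
    have t1: "(\<lambda>n. R ((K ^^ Suc n) u) x) \<longlonglongrightarrow> 0"
    proof (rule tendsto_norm_zero_cancel, rule tendsto_sandwich[OF _ _ tendsto_const to0])
      have "cmod (R ((K ^^ Suc n) u) x) \<le> r ^ n * (r * (1 / (1 - r) * ell2_norm X u))" for n
      proof -
        have "cmod (R ((K ^^ Suc n) u) x) \<le> ell2_norm X (R ((K ^^ Suc n) u))"
          using bd[OF pow[OF u, of "Suc n"]] by (intro cmod_le_ell2_norm) blast
        also have "\<dots> \<le> 1 / (1 - r) * ell2_norm X ((K ^^ Suc n) u)"
          using bd[OF pow[OF u, of "Suc n"]] by blast
        also have "\<dots> \<le> 1 / (1 - r) * (r ^ Suc n * ell2_norm X u)"
          using r by (intro mult_left_mono pow_norm u) auto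
        finally show ?thesis by (simp add: algebra_simps)
      qed
      then show "\<forall>\<^sub>F n in sequentially. cmod (R ((K ^^ Suc n) u) x)
          \<le> r ^ n * (r * (1 / (1 - r) * ell2_norm X u))" by simp
    qed auto
    have t2: "(\<lambda>n. K (R ((K ^^ n) u)) x) \<longlonglongrightarrow> 0"
    proof (rule tendsto_norm_zero_cancel, rule tendsto_sandwich[OF _ _ tendsto_const to0])
      have "cmod (K (R ((K ^^ n) u)) x) \<le> r ^ n * (r * (1 / (1 - r)) * ell2_norm X u)" for n
      proof -
        have "cmod (K (R ((K ^^ n) u)) x) \<le> ell2_norm X (K (R ((K ^^ n) u)))"
          using bd[OF pow[OF u, of n]] by (intro cmod_le_ell2_norm bounded_operatorD(1)[OF K]) blast
        also have "\<dots> \<le> r * ell2_norm X (R ((K ^^ n) u))"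
          using bd[OF pow[OF u]] Kr by blast
        also have "\<dots> \<le> r * (1 / (1 - r) * ell2_norm X ((K ^^ n) u))"
          using bd[OF pow[OF u]] r by (intro mult_left_mono) auto
        also have "\<dots> \<le> r * (1 / (1 - r) * (r ^ n * ell2_norm X u))"
          using r by (intro mult_left_mono pow_norm u) auto
        finally show ?thesis by (simp add: algebra_simps)
      qed
      then show "\<forall>\<^sub>F n in sequentially. cmod (K (R ((K ^^ n) u)) x)
          \<le> r ^ n * (r * (1 / (1 - r)) * ell2_norm X u)" by simp
    qed auto
    have "(\<lambda>n. K (R ((K ^^ n) u)) x - R ((K ^^ Suc n) u) x) \<longlonglongrightarrow> 0 - 0"
      by (intro tendsto_diff t1 t2)
    then have "K (R u) x - (R u x - u x) = 0"
      by (simp only: defect tendsto_const_iff[OF sequentially_bot] diff_zero)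
    then show "K (R u) x = R u x - u x" by simp
  qed
  show thesis using that R RK KR by blast
qed

section \<open>The top of the quadratic form is the top of the spectrum\<close>

definition form_top :: "'x set \<Rightarrow> (('x \<Rightarrow> complex) \<Rightarrow> ('x \<Rightarrow> complex)) \<Rightarrow> real" where
  "form_top X A = Sup {ell2_inner X (A u) u | u. u \<in> ell2 X \<and> ell2_inner X u u = 1}"

text \<open>The pointwise inequality \<open>abs_inner_le\<close> replaces Cauchy-Schwarz in
  \<open>ell2\<close>. This gives the crude constant \<open>(C^2 + 1) / 2\<close>; later only its
  existence matters.\<close>

lemma bounded_operator_form_boundE:
  assumes A: "bounded_operator_on X A"
  obtains C where "0 \<le> C" "\<And>u. u \<in> ell2 X \<Longrightarrow> \<bar>ell2_inner X (A u) u\<bar> \<le> C * ell2_inner X u u"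
proof -
  obtain C where C: "0 \<le> C" "\<And>u. u \<in> ell2 X \<Longrightarrow> ell2_norm X (A u) \<le> C * ell2_norm X u"
    using bounded_operator_boundE[OF A] by metis
  have "\<bar>ell2_inner X (A u) u\<bar> \<le> (C\<^sup>2 + 1) / 2 * ell2_inner X u u" if u: "u \<in> ell2 X" for u
  proof -
    note Au = bounded_operatorD(1)[OF A u]
    have s: "(\<lambda>x. ((cmod (A u x))\<^sup>2 + (cmod (u x))\<^sup>2) * (1 / 2)) summable_on X"
      by (intro summable_on_cmult_left summable_on_add ell2_summable Au u)
    have "\<bar>ell2_inner X (A u) u\<bar> \<le> (\<Sum>\<^sub>\<infinity>x\<in>X. ((cmod (A u x))\<^sup>2 + (cmod (u x))\<^sup>2) * (1 / 2))"
      unfolding ell2_inner_def real_norm_def[symmetric]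
      by (rule norm_infsum_le[OF has_sum_infsum[OF ell2_inner_summable[OF Au u]] has_sum_infsum[OF s]])
        (use abs_inner_le in auto)
    also have "\<dots> = (ell2_inner X (A u) (A u) + ell2_inner X u u) / 2"
      by (subst infsum_cmult_left') (simp add: infsum_add ell2_summable Au u ell2_inner_self)
    also have "\<dots> \<le> ((C * ell2_norm X u)\<^sup>2 + ell2_inner X u u) / 2"
      using power_mono[OF C(2)[OF u] ell2_norm_nonneg, of 2] by (simp add: ell2_norm_square)
    also have "\<dots> = (C\<^sup>2 + 1) / 2 * ell2_inner X u u"
      by (simp add: power_mult_distrib ell2_norm_square algebra_simps add_divide_distrib)
    finally show ?thesis .
  qed
  then show thesis by (intro that[of "(C\<^sup>2 + 1) / 2"]) auto
qed

lemma form_top_upper: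
  assumes A: "bounded_operator_on X A" and u: "u \<in> ell2 X"
  shows "ell2_inner X (A u) u \<le> form_top X A * ell2_inner X u u"
proof (cases "u = (\<lambda>_. 0)")
  case True
  then show ?thesis by (simp add: ell2_inner_def)
next
  case False
  define N where "N = ell2_norm X u"
  have N: "0 < N"
    using False ell2_norm_eq_0_iff[OF u] ell2_norm_nonneg[of X u] by (simp add: N_def less_le)
  define w where "w = (\<lambda>x. of_real (1 / N) * u x)"
  have w: "w \<in> ell2 X" unfolding w_def by (rule ell2_cmult[OF u])
  have hom: "ell2_inner X (\<lambda>x. of_real (1 / N) * f x) (\<lambda>x. of_real (1 / N) * g x)
      = ell2_inner X f g / N\<^sup>2" for f g
    by (subst ell2_inner_cmult_left, subst ell2_inner_commute, subst ell2_inner_cmult_left)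
      (simp add: ell2_inner_commute power2_eq_square)
  obtain C where C: "0 \<le> C" "\<And>u. u \<in> ell2 X \<Longrightarrow> \<bar>ell2_inner X (A u) u\<bar> \<le> C * ell2_inner X u u"
    using bounded_operator_form_boundE[OF A] by metis
  have "ell2_inner X w w = 1"
    unfolding w_def hom using N by (simp add: N_def ell2_norm_square[symmetric])
  \<comment> \<open>A real \<open>Sup\<close> dominates the members of the set only if the set is
    bounded above; this is where boundedness of \<open>A\<close> enters.\<close>
  moreover have "bdd_above {ell2_inner X (A u) u | u. u \<in> ell2 X \<and> ell2_inner X u u = 1}"
    by (rule bdd_aboveI[of _ C]) (use C(2) in fastforce)
  ultimately have "ell2_inner X (A w) w \<le> form_top X A"
    unfolding form_top_def using w by (intro cSup_upper) auto
  moreover have "ell2_inner X (A w) w = ell2_inner X (A u) u / N\<^sup>2"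
    unfolding w_def bounded_operatorD(3)[OF A u] hom ..
  ultimately show ?thesis
    using N by (simp add: N_def ell2_norm_square[symmetric] field_simps)
qed

lemma form_top_least:
  assumes "X \<noteq> {}"
    and "\<And>u. u \<in> ell2 X \<Longrightarrow> ell2_inner X (A u) u \<le> c * ell2_inner X u u"
  shows "form_top X A \<le> c"
  unfolding form_top_def
proof (rule cSup_least)
  obtain x where "x \<in> X" using assms(1) by blast
  from ell2_unit_vector[OF this]
  show "{ell2_inner X (A u) u | u. u \<in> ell2 X \<and> ell2_inner X u u = 1} \<noteq> {}" by blast
qed (use assms(2) in fastforce)

text \<open>Write \<open>x - A = D (1 - K)\<close>. For large \<open>D\<close> the form of
  \<open>K\<close> lies between 0 and \<open>r < 1\<close> times the squared norm,
  \<open>positive_operator_bound\<close> makes \<open>r\<close> a norm bound, and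
  \<open>neumann_series\<close> inverts \<open>1 - K\<close>.\<close>

lemma above_form_top_not_in_spectrum:
  assumes A: "bounded_operator_on X A" "symmetric_operator_on X A" and x: "form_top X A < x"
  shows "complex_of_real x \<notin> spectrum_on X A"
proof -
  obtain C where C: "0 \<le> C" "\<And>u. u \<in> ell2 X \<Longrightarrow> \<bar>ell2_inner X (A u) u\<bar> \<le> C * ell2_inner X u u"
    using bounded_operator_form_boundE[OF A(1)] by metis
  define c where "c = x - form_top X A"
  \<comment> \<open>Large enough for two purposes: \<open>x + C \<le> D\<close> makes the form of
    \<open>K\<close> nonnegative, and \<open>c < D\<close> makes \<open>r\<close> positive.\<close>
  define D where "D = \<bar>x\<bar> + C + c + 1"
  define r where "r = 1 - c / D"
  have c: "0 < c" and D: "0 < D" and cD: "c < D" using x C(1) by (auto simp: c_def D_def)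
  then have r: "0 < r" "r < 1" by (auto simp: r_def)
  define K where "K = (\<lambda>u y. complex_of_real (1 - x / D) * u y + complex_of_real (1 / D) * A u y)"
  have K: "bounded_operator_on X K" "symmetric_operator_on X K"
    unfolding K_def
    by (intro bounded_operator_affine A, intro symmetric_operator_affine A)
  have Kform: "ell2_inner X (K u) u
      = ((D - x) * ell2_inner X u u + ell2_inner X (A u) u) / D" if u: "u \<in> ell2 X" for u
    unfolding K_def using D
    by (subst ell2_inner_affine_left[OF u bounded_operatorD(1)[OF A(1) u] u])
      (simp add: add_divide_distrib left_diff_distrib diff_divide_distrib)
  have Kge: "0 \<le> ell2_inner X (K u) u" if u: "u \<in> ell2 X" for u
  proof -
    have "C * ell2_inner X u u \<le> (D - x) * ell2_inner X u u"
      using c by (intro mult_right_mono ell2_inner_self_nonneg) (simp add: D_def)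
    then show ?thesis using C(2)[OF u] D by (simp add: Kform[OF u])
  qed
  have Kle: "ell2_inner X (K u) u \<le> r * ell2_inner X u u" if u: "u \<in> ell2 X" for u
  proof -
    have "(D - x) * ell2_inner X u u + ell2_inner X (A u) u \<le> (D - c) * ell2_inner X u u"
      using form_top_upper[OF A(1) u] by (simp add: c_def algebra_simps)
    then have "ell2_inner X (K u) u \<le> (D - c) * ell2_inner X u u / D"
      unfolding Kform[OF u] using D by (intro divide_right_mono) auto
    also have "(D - c) * ell2_inner X u u / D = (D - c) / D * ell2_inner X u u" by simp
    also have "(D - c) / D = r" using D by (simp add: r_def diff_divide_distrib)
    finally show ?thesis .
  qed
  have Knorm: "ell2_norm X (K u) \<le> r * ell2_norm X u" if u: "u \<in> ell2 X" for u
  proof -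
    have "ell2_inner X (K u) (K u) \<le> r * ell2_inner X (K u) u"
      by (rule positive_operator_bound[OF K Kge Kle r(1) u])
    also have "\<dots> \<le> r * (r * ell2_inner X u u)"
      using r by (intro mult_left_mono Kle u) auto
    finally have "(ell2_norm X (K u))\<^sup>2 \<le> (r * ell2_norm X u)\<^sup>2"
      unfolding power_mult_distrib ell2_norm_square power2_eq_square[of r] by (simp add: mult.assoc)
    then show ?thesis by (rule power2_le_imp_le) (use r ell2_norm_nonneg[of X u] in simp)
  qed
  obtain R where R: "bounded_operator_on X R"
    and RK: "\<And>u. u \<in> ell2 X \<Longrightarrow> R (K u) = (\<lambda>x. R u x - u x)"
    and KR: "\<And>u. u \<in> ell2 X \<Longrightarrow> K (R u) = (\<lambda>x. R u x - u x)"
    using neumann_series[OF K(1) less_imp_le[OF r(1)] r(2) Knorm] by blast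
  define t where "t = complex_of_real (1 / D)"
  have t: "complex_of_real D * t = 1" using D by (simp add: t_def)
  \<comment> \<open>Since \<open>A - x = - D (1 - K)\<close>, the resolvent is
    \<open>- R / D\<close>. The zero summand only gives it the shape of
    \<open>bounded_operator_affine\<close>.\<close>
  define S where "S = (\<lambda>u y. 0 * u y + (- t) * R u y)"
  have S: "bounded_operator_on X S"
    unfolding S_def by (rule bounded_operator_affine[OF R])
  have "complex_of_real (1 - x / D) = 1 - x * t" by (simp add: t_def)
  then have AK: "A u y - x * u y = D * (K u y + (- 1) * u y)" for u :: "'a \<Rightarrow> complex" and y
    unfolding K_def t_def[symmetric] using t by algebra
  have "S (\<lambda>y. A u y - x * u y) = u" if u: "u \<in> ell2 X" for u :: "'a \<Rightarrow> complex"
  proof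
    fix y
    have "R (\<lambda>y. D * (K u y + (- 1) * u y)) = (\<lambda>y. D * (R (K u) y + (- 1) * R u y))"
      by (simp only: bounded_operatorD[OF R] bounded_operatorD(1)[OF K(1)] ell2_add ell2_cmult u)
    then have "R (\<lambda>y. A u y - x * u y) y = D * (R u y - u y + (- 1) * R u y)"
      unfolding AK by (simp only: RK[OF u])
    moreover have "S (\<lambda>y. A u y - x * u y) y = - t * R (\<lambda>y. A u y - x * u y) y"
      by (simp only: S_def mult_zero_left add_0_left)
    ultimately show "S (\<lambda>y. A u y - x * u y) y = u y" using t by algebra
  qed
  moreover have "(\<lambda>y. A (S u) y - x * S u y) = u" if u: "u \<in> ell2 X" for u :: "'a \<Rightarrow> complex"
  proof
    fix y
    have "S u = (\<lambda>y. (- t) * R u y)" by (simp add: S_def)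
    moreover from this have "K (S u) = (\<lambda>y. (- t) * (R u y - u y))"
      using bounded_operatorD(3)[OF K(1) bounded_operatorD(1)[OF R u]] by (simp only: KR[OF u])
    ultimately have "A (S u) y - x * S u y = D * ((- t) * (R u y - u y) + (- 1) * ((- t) * R u y))"
      unfolding AK by (simp only:)
    also have "\<dots> = u y" using t by algebra
    finally show "A (S u) y - x * S u y = u y" .
  qed
  ultimately show ?thesis
    unfolding spectrum_on_def mem_Collect_eq not_not by (intro exI[of _ S] conjI S ballI)
qed

text \<open>With \<open>B = M - A\<close>, an inverse bounded by \<open>c\<close> would give
  \<open>|u|^2 <= c^2 |B u|^2 <= c^2 D <B u, u>\<close>. The form of \<open>A\<close> would then
  stay below \<open>M\<close> by a fixed amount, contradicting that \<open>M\<close> is its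
  supremum.\<close>

lemma form_top_in_spectrum:
  assumes A: "bounded_operator_on X A" "symmetric_operator_on X A" and X: "X \<noteq> {}"
  shows "complex_of_real (form_top X A) \<in> spectrum_on X A"
proof -
  define M where "M = form_top X A"
  have False if R: "bounded_operator_on X R"
    and RA: "\<And>u. u \<in> ell2 X \<Longrightarrow> R (\<lambda>x. A u x - complex_of_real M * u x) = u" for R
  proof -
    obtain C where C: "0 \<le> C" "\<And>u. u \<in> ell2 X \<Longrightarrow> \<bar>ell2_inner X (A u) u\<bar> \<le> C * ell2_inner X u u"
      using bounded_operator_form_boundE[OF A(1)] by metis
    obtain c where c: "0 \<le> c" "\<And>u. u \<in> ell2 X \<Longrightarrow> ell2_norm X (R u) \<le> c * ell2_norm X u"
      using bounded_operator_boundE[OF R] by metis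
    define D where "D = \<bar>M\<bar> + C + 1"
    have D: "0 < D" using C(1) by (simp add: D_def)
    define B where "B = (\<lambda>u y. complex_of_real M * u y + complex_of_real (- 1) * A u y)"
    have B: "bounded_operator_on X B" "symmetric_operator_on X B"
      unfolding B_def
      by (intro bounded_operator_affine A, intro symmetric_operator_affine A)
    have Bform: "ell2_inner X (B u) u = M * ell2_inner X u u - ell2_inner X (A u) u"
      if u: "u \<in> ell2 X" for u
      unfolding B_def
      by (subst ell2_inner_affine_left[OF u bounded_operatorD(1)[OF A(1) u] u]) simp
    have Bge: "0 \<le> ell2_inner X (B u) u" if u: "u \<in> ell2 X" for u
      using form_top_upper[OF A(1) u] by (simp add: Bform[OF u] M_def)
    have Ble: "ell2_inner X (B u) u \<le> D * ell2_inner X u u" if u: "u \<in> ell2 X" for u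
    proof -
      have "(M + C) * ell2_inner X u u \<le> D * ell2_inner X u u"
        by (intro mult_right_mono ell2_inner_self_nonneg) (simp add: D_def)
      then show ?thesis using C(2)[OF u] by (simp add: Bform[OF u] algebra_simps)
    qed
    \<comment> \<open>The summand 1 keeps \<open>k\<close> positive even if
      \<open>c = 0\<close>.\<close>
    define k where "k = (c\<^sup>2 + 1) * D"
    have k: "0 < k" using D by (simp add: k_def add_nonneg_pos)
    have "ell2_inner X (A u) u \<le> (M - 1 / k) * ell2_inner X u u" if u: "u \<in> ell2 X" for u
    proof -
      have Bu: "(\<lambda>x. - 1 * B u x) \<in> ell2 X"
        by (intro ell2_cmult bounded_operatorD(1)[OF B(1)] u)
      have "u = R (\<lambda>x. - 1 * B u x)"
        using RA[OF u] by (simp add: B_def)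
      then have "ell2_inner X u u = (ell2_norm X (R (\<lambda>x. - 1 * B u x)))\<^sup>2"
        by (simp only: ell2_norm_square)
      also have "\<dots> \<le> (c * ell2_norm X (\<lambda>x. - 1 * B u x))\<^sup>2"
        by (intro power_mono c Bu ell2_norm_nonneg)
      also have "\<dots> = c\<^sup>2 * ell2_inner X (B u) (B u)"
        by (subst ell2_norm_cmult) (simp add: power_mult_distrib ell2_norm_square)
      also have "\<dots> \<le> (c\<^sup>2 + 1) * ell2_inner X (B u) (B u)"
        by (intro mult_right_mono ell2_inner_self_nonneg) simp
      also have "\<dots> \<le> (c\<^sup>2 + 1) * (D * ell2_inner X (B u) u)"
        by (intro mult_left_mono positive_operator_bound[OF B Bge Ble D u]) auto
      finally have "ell2_inner X u u \<le> k * (M * ell2_inner X u u - ell2_inner X (A u) u)"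
        by (simp add: k_def Bform[OF u] mult.assoc)
      then show ?thesis using k by (simp add: field_simps)
    qed
    then have "M \<le> M - 1 / k" unfolding M_def by (rule form_top_least[OF X])
    then show False using k by simp
  qed
  then show ?thesis unfolding spectrum_on_def M_def by blast
qed

text \<open>The supremum is a maximum: the top of the form belongs to the spectrum and no real
  number above it does.\<close>

theorem Sup_spectrum_eq_form_top:
  assumes "bounded_operator_on X A" "symmetric_operator_on X A" "X \<noteq> {}"
  shows "Sup {x. complex_of_real x \<in> spectrum_on X A} = form_top X A"
  by (intro cSup_eq_maximum)
    (use form_top_in_spectrum[OF assms] above_form_top_not_in_spectrum[OF assms(1,2)]
      in \<open>auto simp: not_less[symmetric]\<close>)

section \<open>Jacobi operators with bounded coefficients\<close>

text \<open>Isolates what a possibly infinite graph must satisfy for its Jacobi operator to be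
  bounded and symmetric. Finiteness of \<open>out_arcs\<close> is stated separately because
  \<open>card\<close> of an infinite set is 0, so the degree bound does not imply it.\<close>

locale bounded_jacobi = bidirected_digraph T arev
  for T :: "('w, 'f) pre_digraph" and arev :: "'f \<Rightarrow> 'f" +
  fixes a :: "'f \<Rightarrow> real" and b :: "'w \<Rightarrow> real" and d :: nat and A B :: real
  assumes finite_out_arcs: "x \<in> verts T \<Longrightarrow> finite (out_arcs T x)"
    and out_degree_le: "x \<in> verts T \<Longrightarrow> card (out_arcs T x) \<le> d"
    and abs_a_le: "e \<in> arcs T \<Longrightarrow> \<bar>a e\<bar> \<le> A"
    and a_arev: "e \<in> arcs T \<Longrightarrow> a (arev e) = a e"
    and abs_b_le: "x \<in> verts T \<Longrightarrow> \<bar>b x\<bar> \<le> B"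
begin

section \<open>Passing between sums over vertices and sums over arcs\<close>

lemma bij_betw_arcs: "bij_betw snd (Sigma (verts T) (out_arcs T)) (arcs T)"
  by (rule bij_betw_byWitness[where f' = "\<lambda>e. (tail T e, e)"]) auto

lemma bij_betw_arev: "bij_betw arev (arcs T) (arcs T)"
  by (rule permutes_imp_bij[OF arev_permutes_arcs])

text \<open>Fubini for the partition of the arcs according to their tails.\<close>

lemma has_sum_out_arcs:
  fixes k :: "'f \<Rightarrow> real"
  assumes "k summable_on arcs T"
  shows "((\<lambda>x. \<Sum>e\<in>out_arcs T x. k e) has_sum infsum k (arcs T)) (verts T)"
proof (rule has_sum_SigmaD)
  show "((\<lambda>z. k (snd z)) has_sum infsum k (arcs T)) (Sigma (verts T) (out_arcs T))"
    using has_sum_reindex_bij_betw[OF bij_betw_arcs, of k] assms by simp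
qed (simp add: finite_out_arcs)

lemma infsum_arev: "(\<Sum>\<^sub>\<infinity>e\<in>arcs T. k (arev e)) = infsum k (arcs T)"
  by (rule infsum_reindex_bij_betw[OF bij_betw_arev])

text \<open>The passage from vertices to arcs: each value of \<open>g\<close> is repeated at most
  \<open>d\<close> times, and nonnegativity permits summation over the pairs of vertex and
  arc.\<close>

lemma summable_tail:
  fixes g :: "'w \<Rightarrow> real"
  assumes "g summable_on verts T" "\<And>x. x \<in> verts T \<Longrightarrow> 0 \<le> g x"
  shows "(\<lambda>e. g (tail T e)) summable_on arcs T"
proof -
  have "(\<lambda>x. real (card (out_arcs T x)) * g x) summable_on verts T"
    by (rule summable_on_comparison_test[OF summable_on_cmult_right[OF assms(1), of "real d"]])
      (auto intro!: mult_right_mono mult_nonneg_nonneg assms(2) out_degree_le)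
  then have "(\<lambda>z. g (tail T (snd z))) summable_on Sigma (verts T) (out_arcs T)"
    by (rule summable_on_SigmaI[rotated])
      (auto intro!: has_sum_finiteI finite_out_arcs assms(2))
  then show ?thesis
    using summable_on_reindex_bij_betw[OF bij_betw_arcs, of "\<lambda>e. g (tail T e)"] by simp
qed

lemma summable_head:
  fixes g :: "'w \<Rightarrow> real"
  assumes "g summable_on verts T" "\<And>x. x \<in> verts T \<Longrightarrow> 0 \<le> g x"
  shows "(\<lambda>e. g (head T e)) summable_on arcs T"
proof -
  have "(\<lambda>e. g (tail T (arev e))) summable_on arcs T"
    using summable_on_reindex_bij_betw[OF bij_betw_arev, of "\<lambda>e. g (tail T e)"]
      summable_tail[OF assms] by simp
  then show ?thesis by (rule iffD1[OF summable_on_cong, rotated]) simp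
qed

text \<open>Reversal exchanges heads and tails, so a vertex is the head of as many arcs as leave it,
  at most \<open>d\<close>.\<close>

lemma infsum_head_le:
  fixes g :: "'w \<Rightarrow> real"
  assumes "g summable_on verts T" "\<And>x. x \<in> verts T \<Longrightarrow> 0 \<le> g x"
  shows "(\<Sum>\<^sub>\<infinity>e\<in>arcs T. g (head T e)) \<le> d * infsum g (verts T)"
proof -
  have "(\<Sum>\<^sub>\<infinity>e\<in>arcs T. g (head T e)) = (\<Sum>\<^sub>\<infinity>e\<in>arcs T. g (tail T e))"
    by (subst infsum_arev[symmetric]) (simp cong: infsum_cong)
  also have "\<dots> \<le> (\<Sum>\<^sub>\<infinity>x\<in>verts T. d * g x)"
  proof (rule has_sum_mono[OF has_sum_out_arcs[OF summable_tail[OF assms]] has_sum_infsum])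
    fix x assume x: "x \<in> verts T"
    have "(\<Sum>e\<in>out_arcs T x. g (tail T e)) = card (out_arcs T x) * g x" by simp
    also have "\<dots> \<le> d * g x"
      using x by (intro mult_right_mono assms(2)) (simp_all add: out_degree_le)
    finally show "(\<Sum>e\<in>out_arcs T x. g (tail T e)) \<le> d * g x" .
  qed (auto intro: summable_on_cmult_right[OF assms(1)])
  finally show ?thesis by (simp add: infsum_cmult_right')
qed

lemma arc_summableI:
  assumes "u \<in> ell2 (verts T)" "v \<in> ell2 (verts T)"
    and "\<And>e. e \<in> arcs T \<Longrightarrow> \<bar>k e\<bar> \<le> C * ((cmod (u (head T e)))\<^sup>2 + (cmod (v (tail T e)))\<^sup>2)"
  shows "k summable_on arcs T"
proof -
  have "(\<lambda>e. C * ((cmod (u (head T e)))\<^sup>2 + (cmod (v (tail T e)))\<^sup>2)) summable_on arcs T"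
    by (intro summable_on_cmult_right summable_on_add
        summable_head[of "\<lambda>x. (cmod (u x))\<^sup>2"] summable_tail[of "\<lambda>x. (cmod (v x))\<^sup>2"]
        ell2_summable assms) auto
  then have "(\<lambda>e. norm (k e)) summable_on arcs T"
    by (rule Infinite_Sum.abs_summable_on_comparison_test') (use assms(3) in auto)
  then show ?thesis by (rule abs_summable_summable)
qed

lemma arc_product_summable:
  assumes "u \<in> ell2 (verts T)" "v \<in> ell2 (verts T)"
    and "\<And>e. e \<in> arcs T \<Longrightarrow> \<bar>c e\<bar> \<le> C"
  shows "(\<lambda>e. c e * (u (head T e) \<bullet> v (tail T e))) summable_on arcs T"
proof (rule arc_summableI[OF assms(1,2)])
  fix e assume e: "e \<in> arcs T"
  have "\<bar>c e * (u (head T e) \<bullet> v (tail T e))\<bar>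
      \<le> C * (((cmod (u (head T e)))\<^sup>2 + (cmod (v (tail T e)))\<^sup>2) / 2)"
    unfolding abs_mult using assms(3)[OF e] by (intro mult_mono abs_inner_le) auto
  then show "\<bar>c e * (u (head T e) \<bullet> v (tail T e))\<bar>
      \<le> C / 2 * ((cmod (u (head T e)))\<^sup>2 + (cmod (v (tail T e)))\<^sup>2)" by simp
qed

section \<open>Boundedness, symmetry and the ground state representation\<close>

lemma jacobi_op_square_le:
  assumes x: "x \<in> verts T"
  shows "(cmod (jacobi_op T a b u x))\<^sup>2
    \<le> 2 * B\<^sup>2 * (cmod (u x))\<^sup>2 + 2 * real d * A\<^sup>2 * (\<Sum>e\<in>out_arcs T x. (cmod (u (head T e)))\<^sup>2)"
proof -
  let ?s = "\<Sum>e\<in>out_arcs T x. a e *\<^sub>R u (head T e)"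
  have "cmod (jacobi_op T a b u x) \<le> B * cmod (u x) + A * (\<Sum>e\<in>out_arcs T x. cmod (u (head T e)))"
  proof -
    have "cmod (jacobi_op T a b u x) \<le> cmod (b x *\<^sub>R u x) + cmod ?s"
      using x norm_triangle_ineq[of "b x *\<^sub>R u x" ?s] by (simp add: jacobi_op_def)
    also have "cmod (b x *\<^sub>R u x) \<le> B * cmod (u x)"
      using abs_b_le[OF x] by (simp add: mult_right_mono)
    also have "cmod ?s \<le> (\<Sum>e\<in>out_arcs T x. A * cmod (u (head T e)))"
      by (rule order_trans[OF norm_sum]) (auto intro!: sum_mono mult_right_mono abs_a_le)
    finally show ?thesis by (simp add: sum_distrib_left)
  qed
  then have "(cmod (jacobi_op T a b u x))\<^sup>2
      \<le> (B * cmod (u x) + A * (\<Sum>e\<in>out_arcs T x. cmod (u (head T e))))\<^sup>2"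
    by (intro power_mono) auto
  also have "\<dots> \<le> 2 * (B * cmod (u x))\<^sup>2 + 2 * (A * (\<Sum>e\<in>out_arcs T x. cmod (u (head T e))))\<^sup>2"
    using sum_squares_bound[of "B * cmod (u x)" "A * (\<Sum>e\<in>out_arcs T x. cmod (u (head T e)))"]
    unfolding power2_sum by linarith
  also have "(A * (\<Sum>e\<in>out_arcs T x. cmod (u (head T e))))\<^sup>2
      \<le> A\<^sup>2 * (d * (\<Sum>e\<in>out_arcs T x. (cmod (u (head T e)))\<^sup>2))"
  proof -
    have "(\<Sum>e\<in>out_arcs T x. cmod (u (head T e)))\<^sup>2
        \<le> card (out_arcs T x) * (\<Sum>e\<in>out_arcs T x. (cmod (u (head T e)))\<^sup>2)"
      using sum_squared_le_sum_of_squares[of "\<lambda>e. cmod (u (head T e))" "out_arcs T x"] by (simp add: mult.commute)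
    also have "\<dots> \<le> d * (\<Sum>e\<in>out_arcs T x. (cmod (u (head T e)))\<^sup>2)"
      using out_degree_le[OF x] by (intro mult_right_mono sum_nonneg) auto
    finally show ?thesis unfolding power_mult_distrib by (intro mult_left_mono) auto
  qed
  finally show ?thesis by (simp add: power_mult_distrib mult_ac)
qed

lemma bounded_operator_jacobi: "bounded_operator_on (verts T) (jacobi_op T a b)"
proof -
  \<comment> \<open>One factor \<open>d\<close> comes from Cauchy-Schwarz over the arcs at a vertex,
    the other from \<open>infsum_head_le\<close>.\<close>
  define C where "C = 2 * B\<^sup>2 + 2 * (real d)\<^sup>2 * A\<^sup>2"
  have main: "jacobi_op T a b u \<in> ell2 (verts T) \<and>
      ell2_norm (verts T) (jacobi_op T a b u) \<le> sqrt C * ell2_norm (verts T) u"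
    if u: "u \<in> ell2 (verts T)" for u
  proof
    let ?m = "\<lambda>x. 2 * B\<^sup>2 * (cmod (u x))\<^sup>2
      + 2 * real d * A\<^sup>2 * (\<Sum>e\<in>out_arcs T x. (cmod (u (head T e)))\<^sup>2)"
    have h: "(\<lambda>e. (cmod (u (head T e)))\<^sup>2) summable_on arcs T"
      by (intro summable_head[of "\<lambda>x. (cmod (u x))\<^sup>2"] ell2_summable u) auto
    have m: "(?m has_sum (2 * B\<^sup>2 * ell2_inner (verts T) u u
        + 2 * real d * A\<^sup>2 * (\<Sum>\<^sub>\<infinity>e\<in>arcs T. (cmod (u (head T e)))\<^sup>2))) (verts T)"
      unfolding ell2_inner_self
      by (intro has_sum_add has_sum_cmult_right has_sum_infsum ell2_summable u has_sum_out_arcs h)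
    have "(\<lambda>x. (cmod (jacobi_op T a b u x))\<^sup>2) summable_on verts T"
      by (rule summable_on_comparison_test[OF has_sum_imp_summable[OF m] jacobi_op_square_le]) simp_all
    then show J: "jacobi_op T a b u \<in> ell2 (verts T)"
      by (simp add: ell2_def) (simp add: jacobi_op_def)
    have "ell2_inner (verts T) (jacobi_op T a b u) (jacobi_op T a b u)
        \<le> 2 * B\<^sup>2 * ell2_inner (verts T) u u
        + 2 * real d * A\<^sup>2 * (\<Sum>\<^sub>\<infinity>e\<in>arcs T. (cmod (u (head T e)))\<^sup>2)"
      unfolding ell2_inner_self[of _ "jacobi_op T a b u"]
      by (rule has_sum_mono[OF has_sum_infsum[OF ell2_summable[OF J]] m])
        (rule jacobi_op_square_le)
    also have "\<dots> \<le> 2 * B\<^sup>2 * ell2_inner (verts T) u u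
        + 2 * real d * A\<^sup>2 * (d * ell2_inner (verts T) u u)"
      unfolding ell2_inner_self
      by (intro add_left_mono mult_left_mono infsum_head_le[of "\<lambda>x. (cmod (u x))\<^sup>2"]
          ell2_summable u) auto
    also have "\<dots> = C * ell2_inner (verts T) u u"
      by (simp add: C_def algebra_simps power2_eq_square)
    finally show "ell2_norm (verts T) (jacobi_op T a b u) \<le> sqrt C * ell2_norm (verts T) u"
      by (simp add: ell2_norm_eq flip: real_sqrt_mult)
  qed
  show ?thesis
    unfolding bounded_operator_on_def
  proof (intro conjI ballI allI)
    show "jacobi_op T a b (\<lambda>x. u x + v x) = (\<lambda>x. jacobi_op T a b u x + jacobi_op T a b v x)" for u v
      by (auto simp: jacobi_op_def scaleR_add_right sum.distrib)
    show "jacobi_op T a b (\<lambda>x. c * u x) = (\<lambda>x. c * jacobi_op T a b u x)" for c :: complex and u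
      by (auto simp: jacobi_op_def sum_distrib_left algebra_simps)
  qed (use main in blast)+
qed

text \<open>With the neighbour terms collected into one sum over arcs, symmetry of the operator
  reduces to reindexing by \<open>arev\<close>.\<close>

lemma jacobi_op_inner:
  assumes u: "u \<in> ell2 (verts T)" and v: "v \<in> ell2 (verts T)"
  shows "ell2_inner (verts T) (jacobi_op T a b u) v
    = (\<Sum>\<^sub>\<infinity>x\<in>verts T. b x * (u x \<bullet> v x))
      + (\<Sum>\<^sub>\<infinity>e\<in>arcs T. a e * (u (head T e) \<bullet> v (tail T e)))"
proof -
  have "(\<lambda>x. norm (b x * (u x \<bullet> v x))) summable_on verts T"
  proof (rule Infinite_Sum.abs_summable_on_comparison_test')
    show "(\<lambda>x. B * (((cmod (u x))\<^sup>2 + (cmod (v x))\<^sup>2) * (1 / 2))) summable_on verts T"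
      by (intro summable_on_cmult_right summable_on_cmult_left summable_on_add ell2_summable u v)
    fix x assume "x \<in> verts T"
    then show "norm (b x * (u x \<bullet> v x)) \<le> B * (((cmod (u x))\<^sup>2 + (cmod (v x))\<^sup>2) * (1 / 2))"
      unfolding real_norm_def abs_mult using abs_b_le[of x] abs_inner_le[of "u x" "v x"]
      by (intro mult_mono) auto
  qed
  then have sb: "(\<lambda>x. b x * (u x \<bullet> v x)) summable_on verts T" by (rule abs_summable_summable)
  have "((\<lambda>x. b x * (u x \<bullet> v x) + (\<Sum>e\<in>out_arcs T x. a e * (u (head T e) \<bullet> v (tail T e)))) has_sum
      ((\<Sum>\<^sub>\<infinity>x\<in>verts T. b x * (u x \<bullet> v x))
      + (\<Sum>\<^sub>\<infinity>e\<in>arcs T. a e * (u (head T e) \<bullet> v (tail T e))))) (verts T)"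
    by (intro has_sum_add has_sum_infsum sb has_sum_out_arcs arc_product_summable[where C = A] u v abs_a_le)
  then show ?thesis
    unfolding ell2_inner_def
    by (intro infsumI, elim iffD1[OF has_sum_cong, rotated])
      (simp add: jacobi_op_def inner_add_left inner_sum_left)
qed

lemma symmetric_operator_jacobi: "symmetric_operator_on (verts T) (jacobi_op T a b)"
  unfolding symmetric_operator_on_def
proof (intro ballI)
  fix u v assume u: "u \<in> ell2 (verts T)" and v: "v \<in> ell2 (verts T)"
  have "(\<Sum>\<^sub>\<infinity>e\<in>arcs T. a e * (u (head T e) \<bullet> v (tail T e)))
      = (\<Sum>\<^sub>\<infinity>e\<in>arcs T. a e * (v (head T e) \<bullet> u (tail T e)))"
    by (subst infsum_arev[symmetric]) (simp add: a_arev inner_commute cong: infsum_cong)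
  then show "ell2_inner (verts T) (jacobi_op T a b u) v
      = ell2_inner (verts T) u (jacobi_op T a b v)"
    by (simp add: ell2_inner_commute[of _ u "jacobi_op T a b v"] jacobi_op_inner u v inner_commute)
qed

text \<open>Eliminating the potential via $b_x \phi_x = s \phi_x - \sum a_e \phi_{head}$ and pairing each
  arc with its reverse turns the form of $s - H$ into a Dirichlet form.\<close>

lemma ground_state_representation:
  assumes f: "f \<in> ell2 (verts T)"
    and \<phi>: "\<And>x. x \<in> verts T \<Longrightarrow> \<bar>\<phi> x\<bar> \<le> P"
    and eig: "\<And>x. x \<in> verts T \<Longrightarrow> jacobi_op T a b \<phi> x = s * \<phi> x"
  defines "u \<equiv> \<lambda>x. complex_of_real (\<phi> x) * f x"
    and "D \<equiv> \<lambda>e. a e * \<phi> (tail T e) * \<phi> (head T e) * (cmod (f (head T e) - f (tail T e)))\<^sup>2"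
  shows "u \<in> ell2 (verts T)" and "D summable_on arcs T"
    and "s * ell2_inner (verts T) u u - ell2_inner (verts T) (jacobi_op T a b u) u
      = infsum D (arcs T) / 2"
proof -
  have "(\<lambda>x. (cmod (u x))\<^sup>2) summable_on verts T"
  proof (rule summable_on_comparison_test[OF summable_on_cmult_right[OF ell2_summable[OF f], of "P\<^sup>2"]])
    fix x assume "x \<in> verts T"
    then show "(cmod (u x))\<^sup>2 \<le> P\<^sup>2 * (cmod (f x))\<^sup>2"
      using power_mono[OF \<phi>, of x 2]
      by (simp add: u_def norm_mult power_mult_distrib mult_right_mono)
  qed auto
  then show u: "u \<in> ell2 (verts T)" using f by (simp add: ell2_def u_def)
  define w where "w e = a e * \<phi> (tail T e) * \<phi> (head T e)" for e
  have inner_u: "u x \<bullet> u y = \<phi> x * \<phi> y * (f x \<bullet> f y)" for x y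
    by (simp add: u_def flip: scaleR_conv_of_real)
  have w: "\<bar>w e\<bar> \<le> A * P * P" if e: "e \<in> arcs T" for e
    unfolding w_def abs_mult
    using e abs_a_le[OF e] \<phi>[of "tail T e"] \<phi>[of "head T e"]
    by (intro mult_mono) (auto intro: order_trans[OF abs_ge_zero] mult_nonneg_nonneg)
  have D: "D e = w e * (cmod (f (head T e) - f (tail T e)))\<^sup>2" for e
    by (simp add: D_def w_def)
  show sD: "D summable_on arcs T"
  proof (rule arc_summableI[OF f f])
    fix e assume e: "e \<in> arcs T"
    have "(cmod (f (head T e) - f (tail T e)))\<^sup>2
        \<le> 2 * ((cmod (f (head T e)))\<^sup>2 + (cmod (f (tail T e)))\<^sup>2)"
      using abs_inner_le[of "f (head T e)" "f (tail T e)"]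
      by (simp add: power2_norm_eq_inner inner_diff_left inner_diff_right inner_commute abs_le_iff)
    then have "\<bar>D e\<bar> \<le> (A * P * P) * (2 * ((cmod (f (head T e)))\<^sup>2 + (cmod (f (tail T e)))\<^sup>2))"
      unfolding D abs_mult using w[OF e] by (intro mult_mono) auto
    then show "\<bar>D e\<bar> \<le> (A * P * P * 2) * ((cmod (f (head T e)))\<^sup>2 + (cmod (f (tail T e)))\<^sup>2)"
      by (simp add: algebra_simps)
  qed
  have s1: "(\<lambda>e. w e * (f (head T e) \<bullet> f (tail T e))) summable_on arcs T"
    by (rule arc_product_summable[OF f f w])
  have s2: "(\<lambda>e. w e * (cmod (f (tail T e)))\<^sup>2) summable_on arcs T"
  proof (rule arc_summableI[OF f f])
    fix e assume e: "e \<in> arcs T"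
    show "\<bar>w e * (cmod (f (tail T e)))\<^sup>2\<bar>
        \<le> (A * P * P) * ((cmod (f (head T e)))\<^sup>2 + (cmod (f (tail T e)))\<^sup>2)"
      unfolding abs_mult using w[OF e] by (intro mult_mono) auto
  qed
  \<comment> \<open>The one-sided contribution of an arc, grouped by its tail to match the
    eigenvalue equation there. It is not symmetric itself: only \<open>k e + k (arev e)\<close>
    equals \<open>- D e\<close>.\<close>
  define k where "k e = w e * (f (head T e) \<bullet> f (tail T e)) - w e * (cmod (f (tail T e)))\<^sup>2" for e
  have sk: "k summable_on arcs T"
    unfolding k_def diff_conv_add_uminus
    by (intro summable_on_add s1) (simp add: summable_on_uminus s2)
  have "((\<lambda>x. s * (u x \<bullet> u x) + (\<Sum>e\<in>out_arcs T x. k e)) has_sum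
      (s * ell2_inner (verts T) u u + infsum k (arcs T))) (verts T)"
    unfolding ell2_inner_def
    by (intro has_sum_add has_sum_cmult_right has_sum_infsum ell2_inner_summable u
        has_sum_out_arcs sk)
  moreover have "s * (u x \<bullet> u x) + (\<Sum>e\<in>out_arcs T x. k e) = jacobi_op T a b u x \<bullet> u x"
    if x: "x \<in> verts T" for x
  proof -
    have "s * \<phi> x = b x * \<phi> x + (\<Sum>e\<in>out_arcs T x. a e * \<phi> (head T e))"
      using eig[OF x] x by (simp add: jacobi_op_def)
    then have "s * (u x \<bullet> u x)
        = (b x * \<phi> x + (\<Sum>e\<in>out_arcs T x. a e * \<phi> (head T e))) * \<phi> x * (f x \<bullet> f x)"
      by (simp add: inner_u)
    also have "\<dots> = b x * (u x \<bullet> u x) + (\<Sum>e\<in>out_arcs T x. a e * \<phi> (head T e)) * \<phi> x * (f x \<bullet> f x)"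
      by (simp add: inner_u algebra_simps)
    also have "(\<Sum>e\<in>out_arcs T x. a e * \<phi> (head T e)) * \<phi> x * (f x \<bullet> f x)
        = (\<Sum>e\<in>out_arcs T x. w e * (cmod (f (tail T e)))\<^sup>2)"
      unfolding sum_distrib_right
      by (rule sum.cong) (auto simp: w_def power2_norm_eq_inner)
    finally have "s * (u x \<bullet> u x) + (\<Sum>e\<in>out_arcs T x. k e)
        = b x * (u x \<bullet> u x) + (\<Sum>e\<in>out_arcs T x. w e * (f (head T e) \<bullet> f (tail T e)))"
      by (simp add: k_def sum_subtractf)
    also have "(\<Sum>e\<in>out_arcs T x. w e * (f (head T e) \<bullet> f (tail T e)))
        = (\<Sum>e\<in>out_arcs T x. a e * (u (head T e) \<bullet> u x))"
      by (rule sum.cong) (auto simp: w_def inner_u)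
    also have "b x * (u x \<bullet> u x) + \<dots> = jacobi_op T a b u x \<bullet> u x"
      using x by (simp add: jacobi_op_def inner_add_left inner_sum_left)
    finally show ?thesis .
  qed
  ultimately have form: "ell2_inner (verts T) (jacobi_op T a b u) u
      = s * ell2_inner (verts T) u u + infsum k (arcs T)"
    unfolding ell2_inner_def by (intro infsumI, elim iffD1[OF has_sum_cong, rotated]) simp
  \<comment> \<open>Symmetrization over the two arcs of an edge; it is the source of the factor 1/2
    in front of the Dirichlet sum.\<close>
  have "2 * infsum k (arcs T) = infsum k (arcs T) + (\<Sum>\<^sub>\<infinity>e\<in>arcs T. k (arev e))"
    by (simp add: infsum_arev)
  also have "\<dots> = (\<Sum>\<^sub>\<infinity>e\<in>arcs T. k e + k (arev e))"
    by (rule infsum_add[symmetric, OF sk])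
      (simp add: summable_on_reindex_bij_betw[OF bij_betw_arev] sk)
  also have "\<dots> = (\<Sum>\<^sub>\<infinity>e\<in>arcs T. - D e)"
    by (rule infsum_cong)
      (simp add: k_def D w_def a_arev power2_norm_eq_inner inner_diff_left inner_diff_right
        inner_commute algebra_simps)
  finally have "2 * infsum k (arcs T) = - infsum D (arcs T)"
    by (simp add: infsum_uminus)
  then show "s * ell2_inner (verts T) u u - ell2_inner (verts T) (jacobi_op T a b u) u
      = infsum D (arcs T) / 2"
    by (simp add: form)
qed

end

section \<open>Comparison of the gaps\<close>

text \<open>One parameter set over a covering, so that the comparison can use two instances over the
  same covering and then exchange them.\<close>

locale perron_cover =
  fixes G :: "('v, 'e) pre_digraph" and arevG :: "'e \<Rightarrow> 'e"
    and T :: "('w, 'f) pre_digraph" and arevT :: "'f \<Rightarrow> 'f"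
    and p :: "'w \<Rightarrow> 'v" and q :: "'f \<Rightarrow> 'e"
    and a :: "'e \<Rightarrow> real" and b \<psi> :: "'v \<Rightarrow> real"
  assumes graph: "finite_leafless_graph G arevG"
    and cover: "universal_cover T arevT G arevG p q"
    and parameters: "jacobi_parameters G arevG a b"
    and perron: "perron_eigenvector G a b \<psi>"
begin

interpretation G: finite_leafless_graph G arevG by (rule graph)

lemma finite_base: "finite (arcs G)" "finite (verts G)"
  by (rule G.finite_arcs, rule G.finite_verts)

lemma nonempty_verts_base: "verts G \<noteq> {}"
  using G.graph_connected by (auto simp: connected_def strongly_connected_def)

text \<open>Ensures that \<open>S\<close> is a supremum over a nonempty set, and hence
  positive.\<close>

lemma nonempty_arcs_base: "arcs G \<noteq> {}"
proof -
  obtain v where "v \<in> verts G" using nonempty_verts_base by blast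
  then have "card (out_arcs G v) \<noteq> 0" using G.leafless[of v] by (simp add: out_degree_def)
  then have "out_arcs G v \<noteq> {}" by force
  then show ?thesis by auto
qed

lemma ends_in_verts_base: "e \<in> arcs G \<Longrightarrow> tail G e \<in> verts G \<and> head G e \<in> verts G"
  by simp

lemma a_pos: "e \<in> arcs G \<Longrightarrow> 0 < a e"
  using parameters by (simp add: jacobi_parameters_def)

lemma perron_pos: "v \<in> verts G \<Longrightarrow> 0 < \<psi> v"
  using perron by (simp add: perron_eigenvector_def)

lemma covering: "covering_map T arevT G arevG p q"
  using cover by (simp add: universal_cover_def)

lemma vertex_map: "x \<in> verts T \<Longrightarrow> p x \<in> verts G"
  using covering by (auto simp: covering_map_def)

lemma arc_map:
  assumes "e \<in> arcs T"
  shows "q e \<in> arcs G" "tail G (q e) = p (tail T e)" "head G (q e) = p (head T e)"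
    and "q (arevT e) = arevG (q e)"
  using covering assms by (auto simp: covering_map_def)

lemma out_arcs_bij: "x \<in> verts T \<Longrightarrow> bij_betw q (out_arcs T x) (out_arcs G (p x))"
  using covering by (simp add: covering_map_def)

lemma nonempty_verts: "verts T \<noteq> {}"
  using covering nonempty_verts_base by (auto simp: covering_map_def)

lemma finite_out_arcs_base: "finite (out_arcs G v)"
  by (rule finite_subset[OF _ finite_base(1)]) auto

text \<open>Finiteness of \<open>G\<close> gives the uniform bounds: lifted coefficients take
  finitely many values and the covering preserves out-degrees. Sums of absolute values serve in
  place of maxima.\<close>

sublocale bounded_jacobi T arevT "a \<circ> q" "b \<circ> p" "card (arcs G)"
  "\<Sum>e\<in>arcs G. \<bar>a e\<bar>" "\<Sum>v\<in>verts G. \<bar>b v\<bar>"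
proof -
  interpret bidirected_digraph T arevT
    using cover by (simp add: universal_cover_def tree_graph_def)
  show "bounded_jacobi T arevT (a \<circ> q) (b \<circ> p) (card (arcs G))
      (\<Sum>e\<in>arcs G. \<bar>a e\<bar>) (\<Sum>v\<in>verts G. \<bar>b v\<bar>)"
  proof unfold_locales
    fix x assume x: "x \<in> verts T"
    show "finite (out_arcs T x)"
      using bij_betw_finite[OF out_arcs_bij[OF x]] finite_out_arcs_base by simp
    have "card (out_arcs T x) = card (out_arcs G (p x))"
      by (rule bij_betw_same_card[OF out_arcs_bij[OF x]])
    also have "\<dots> \<le> card (arcs G)" by (rule card_mono[OF finite_base(1)]) auto
    finally show "card (out_arcs T x) \<le> card (arcs G)" .
    show "\<bar>(b \<circ> p) x\<bar> \<le> (\<Sum>v\<in>verts G. \<bar>b v\<bar>)"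
      using member_le_sum[of "p x" "verts G" "\<lambda>v. \<bar>b v\<bar>"] vertex_map[OF x] finite_base by simp
  next
    fix e assume e: "e \<in> arcs T"
    show "\<bar>(a \<circ> q) e\<bar> \<le> (\<Sum>e\<in>arcs G. \<bar>a e\<bar>)"
      using member_le_sum[of "q e" "arcs G" "\<lambda>e. \<bar>a e\<bar>"] arc_map[OF e] finite_base by simp
    show "(a \<circ> q) (arevT e) = (a \<circ> q) e"
      using parameters arc_map[OF e] by (simp add: jacobi_parameters_def)
  qed
qed

section \<open>The gap as the best constant in an energy inequality\<close>

definition lift :: "('w \<Rightarrow> complex) \<Rightarrow> 'w \<Rightarrow> complex" where
  "lift f = (\<lambda>x. complex_of_real (\<psi> (p x)) * f x)"

text \<open>The conductance of an edge after the ground state transform; \<open>S\<close> is the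
  supremum of the quotients of two such weights.\<close>

definition weight :: "'e \<Rightarrow> real" where
  "weight e = a e * (\<psi> (tail G e) * \<psi> (head G e))"

definition energy :: "('w \<Rightarrow> complex) \<Rightarrow> real" where
  "energy f = (\<Sum>\<^sub>\<infinity>e\<in>arcs T. weight (q e) * (cmod (f (head T e) - f (tail T e)))\<^sup>2) / 2"

lemma weight_pos: "e \<in> arcs G \<Longrightarrow> 0 < weight e"
  by (simp add: weight_def a_pos perron_pos ends_in_verts_base)

lemma perron_bound: "v \<in> verts G \<Longrightarrow> \<bar>\<psi> v\<bar> \<le> (\<Sum>v\<in>verts G. \<bar>\<psi> v\<bar>)"
  using member_le_sum[of v "verts G" "\<lambda>v. \<bar>\<psi> v\<bar>"] finite_base by simp

text \<open>The operator at \<open>x\<close> sees only the arcs leaving \<open>x\<close>, and the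
  covering maps these bijectively onto the arcs leaving \<open>p x\<close>.\<close>

lemma perron_lift:
  assumes x: "x \<in> verts T"
  shows "jacobi_op T (a \<circ> q) (b \<circ> p) (\<psi> \<circ> p) x = largest_eigenvalue G a b * (\<psi> \<circ> p) x"
proof -
  have "(\<Sum>e\<in>out_arcs T x. a (q e) * \<psi> (p (head T e)))
      = (\<Sum>e\<in>out_arcs T x. a (q e) * \<psi> (head G (q e)))"
    by (rule sum.cong) (auto simp: arc_map)
  also have "\<dots> = (\<Sum>e\<in>out_arcs G (p x). a e * \<psi> (head G e))"
    by (rule sum.reindex_bij_betw[OF out_arcs_bij[OF x]])
  finally have "jacobi_op T (a \<circ> q) (b \<circ> p) (\<psi> \<circ> p) x = jacobi_op G a b \<psi> (p x)"
    using x vertex_map[OF x] by (simp add: jacobi_op_def)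
  then show ?thesis
    using perron vertex_map[OF x] by (simp add: perron_eigenvector_def)
qed

lemma lift_form:
  assumes f: "f \<in> ell2 (verts T)"
  shows "lift f \<in> ell2 (verts T)"
    and "(\<lambda>e. weight (q e) * (cmod (f (head T e) - f (tail T e)))\<^sup>2) summable_on arcs T"
    and "largest_eigenvalue G a b * ell2_inner (verts T) (lift f) (lift f)
      - ell2_inner (verts T) (periodic_jacobi T p q a b (lift f)) (lift f) = energy f"
proof -
  note gs = ground_state_representation[OF f, of "\<psi> \<circ> p" "\<Sum>v\<in>verts G. \<bar>\<psi> v\<bar>",
      OF _ perron_lift, unfolded comp_apply, OF perron_bound[OF vertex_map]]
  have w: "weight (q e) * (cmod (f (head T e) - f (tail T e)))\<^sup>2
      = a (q e) * \<psi> (p (tail T e)) * \<psi> (p (head T e)) * (cmod (f (head T e) - f (tail T e)))\<^sup>2"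
    if "e \<in> arcs T" for e
    using that by (simp add: weight_def arc_map)
  show "lift f \<in> ell2 (verts T)" unfolding lift_def by (rule gs(1))
  show "(\<lambda>e. weight (q e) * (cmod (f (head T e) - f (tail T e)))\<^sup>2) summable_on arcs T"
    by (rule iffD2[OF summable_on_cong[OF w] gs(2)])
  show "largest_eigenvalue G a b * ell2_inner (verts T) (lift f) (lift f)
      - ell2_inner (verts T) (periodic_jacobi T p q a b (lift f)) (lift f) = energy f"
    using gs(3) unfolding lift_def energy_def periodic_jacobi_def comp_def
    by (subst infsum_cong[OF w])
qed

lemma energy_nonneg: "0 \<le> energy f"
  unfolding energy_def
  by (auto intro!: divide_nonneg_pos infsum_nonneg mult_nonneg_nonneg less_imp_le[OF weight_pos] arc_map)

text \<open>On the finite set of vertices of \<open>G\<close> the eigenvector has a positive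
  minimum, so dividing by its lift preserves square-summability. Testing lifts therefore tests all
  of \<open>ell2\<close>.\<close>

lemma surj_lift:
  assumes u: "u \<in> ell2 (verts T)"
  obtains f where "f \<in> ell2 (verts T)" "u = lift f"
proof
  define f where "f = (\<lambda>x. u x / complex_of_real (\<psi> (p x)))"
  define m where "m = Min (\<psi> ` verts G)"
  have "m \<in> \<psi> ` verts G"
    unfolding m_def using finite_base nonempty_verts_base by (intro Min_in) auto
  then have m: "0 < m" using perron_pos by auto
  have "(\<lambda>x. (cmod (f x))\<^sup>2) summable_on verts T"
  proof (rule summable_on_comparison_test[OF summable_on_cmult_right[OF ell2_summable[OF u], of "(1 / m)\<^sup>2"]])
    fix x assume "x \<in> verts T"
    then have "m \<le> \<psi> (p x)" unfolding m_def using finite_base vertex_map by (intro Min_le) auto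
    then have "cmod (u x) / \<psi> (p x) \<le> cmod (u x) / m"
      using m by (intro divide_left_mono) auto
    then have "cmod (f x) \<le> 1 / m * cmod (u x)"
      using m \<open>m \<le> \<psi> (p x)\<close> by (simp add: f_def norm_divide)
    then show "(cmod (f x))\<^sup>2 \<le> (1 / m)\<^sup>2 * (cmod (u x))\<^sup>2"
      unfolding power_mult_distrib[symmetric] by (intro power_mono) auto
  qed auto
  then show "f \<in> ell2 (verts T)" using u by (simp add: ell2_def f_def)
  show "u = lift f"
  proof
    fix x
    show "u x = lift f x"
      using u perron_pos[OF vertex_map, of x] by (cases "x \<in> verts T") (auto simp: lift_def f_def ell2_def)
  qed
qed

lemma spectral_top_eq: "spectral_top T p q a b = form_top (verts T) (periodic_jacobi T p q a b)"
  unfolding spectral_top_def periodic_jacobi_def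
  by (rule Sup_spectrum_eq_form_top[OF bounded_operator_jacobi symmetric_operator_jacobi nonempty_verts])

text \<open>Together with \<open>gap_greatest\<close> this describes the gap as the largest
  admissible constant, without quotients and without excluding \<open>f = 0\<close>.\<close>

lemma gap_lower:
  assumes "f \<in> ell2 (verts T)"
  shows "gap G T p q a b * ell2_inner (verts T) (lift f) (lift f) \<le> energy f"
  using form_top_upper[OF bounded_operator_jacobi lift_form(1)[OF assms]] lift_form(3)[OF assms]
  by (simp add: gap_def spectral_top_eq periodic_jacobi_def left_diff_distrib)

lemma gap_greatest:
  assumes c: "\<And>f. f \<in> ell2 (verts T) \<Longrightarrow> c * ell2_inner (verts T) (lift f) (lift f) \<le> energy f"
  shows "c \<le> gap G T p q a b"
proof -
  have "form_top (verts T) (periodic_jacobi T p q a b) \<le> largest_eigenvalue G a b - c"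
  proof (rule form_top_least[OF nonempty_verts])
    fix u assume "u \<in> ell2 (verts T)"
    then obtain f where f: "f \<in> ell2 (verts T)" and u: "u = lift f" by (rule surj_lift)
    show "ell2_inner (verts T) (periodic_jacobi T p q a b u) u
        \<le> (largest_eigenvalue G a b - c) * ell2_inner (verts T) u u"
      using c[OF f] lift_form(3)[OF f] by (simp add: u left_diff_distrib)
  qed
  then show ?thesis by (simp add: gap_def spectral_top_eq)
qed

text \<open>The constant 0 is admissible. The sign is needed in the comparison, where an inequality
  between norms is multiplied by the gap.\<close>

lemma gap_nonneg: "0 \<le> gap G T p q a b"
  by (rule gap_greatest) (simp add: energy_nonneg)

end

text \<open>For each \<open>f\<close>, the first gap times \<open>I\<close> times the second squared
  norm is at most the first energy, hence at most \<open>S\<close> times the second energy. So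
  \<open>I / S\<close> times the first gap is admissible in \<open>R.gap_greatest\<close>.
  Positivity of \<open>S\<close> and \<open>I\<close> is recorded because the final rearrangements
  divide by them.\<close>

lemma gap_comparison:
  fixes a a' :: "'e \<Rightarrow> real" and b b' \<psi> \<psi>' :: "'v \<Rightarrow> real"
  assumes "perron_cover G arevG T arevT p q a b \<psi>" "perron_cover G arevG T arevT p q a' b' \<psi>'"
  defines "S \<equiv> SUP e \<in> arcs G. a e / a' e *
      (\<psi> (tail G e) * \<psi> (head G e) / (\<psi>' (tail G e) * \<psi>' (head G e)))"
    and "I \<equiv> INF j \<in> verts G. (\<psi> j)\<^sup>2 / (\<psi>' j)\<^sup>2"
  shows "0 < S" and "0 < I" and "gap G T p q a b \<le> S / I * gap G T p q a' b'"
proof -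
  interpret L: perron_cover G arevG T arevT p q a b \<psi> by fact
  interpret R: perron_cover G arevG T arevT p q a' b' \<psi>' by fact
  have S_eq: "S = (SUP e \<in> arcs G. L.weight e / R.weight e)"
    by (simp add: S_def L.weight_def R.weight_def)
  have S: "L.weight e / R.weight e \<le> S" if "e \<in> arcs G" for e
    unfolding S_eq using that L.finite_base by (intro cSUP_upper bdd_above_finite) auto
  have I: "I \<le> (\<psi> j)\<^sup>2 / (\<psi>' j)\<^sup>2" if "j \<in> verts G" for j
    unfolding I_def using that L.finite_base by (intro cINF_lower bdd_below_finite) auto
  obtain e where e: "e \<in> arcs G" using L.nonempty_arcs_base by blast
  have "0 < L.weight e / R.weight e"
    by (intro divide_pos_pos L.weight_pos R.weight_pos e)
  then show S_pos: "0 < S" using S[OF e] by linarith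
  \<comment> \<open>An infimum over a finite nonempty set is attained, which gives strict positivity
    rather than mere nonnegativity.\<close>
  have "I \<in> (\<lambda>j. (\<psi> j)\<^sup>2 / (\<psi>' j)\<^sup>2) ` verts G"
    unfolding I_def using L.finite_base L.nonempty_verts_base
    by (subst cInf_eq_Min) (auto intro!: Min_in)
  then obtain j where "j \<in> verts G" "I = (\<psi> j)\<^sup>2 / (\<psi>' j)\<^sup>2" by blast
  then show I_pos: "0 < I"
    using L.perron_pos[of j] R.perron_pos[of j] by simp
  have "I / S * gap G T p q a b \<le> gap G T p q a' b'"
  proof (rule R.gap_greatest)
    fix f assume f: "f \<in> ell2 (verts T)"
    have "I * ell2_inner (verts T) (R.lift f) (R.lift f) = (\<Sum>\<^sub>\<infinity>x\<in>verts T. I * (cmod (R.lift f x))\<^sup>2)"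
      by (simp add: ell2_inner_self infsum_cmult_right')
    also have "\<dots> \<le> ell2_inner (verts T) (L.lift f) (L.lift f)"
      unfolding ell2_inner_self
    proof (rule infsum_mono)
      fix x assume x: "x \<in> verts T"
      have "I * (\<psi>' (p x))\<^sup>2 \<le> (\<psi> (p x))\<^sup>2"
        using I[OF L.vertex_map[OF x]] R.perron_pos[OF R.vertex_map[OF x]] by (simp add: pos_le_divide_eq)
      then show "I * (cmod (R.lift f x))\<^sup>2 \<le> (cmod (L.lift f x))\<^sup>2"
        by (simp add: L.lift_def R.lift_def norm_mult power_mult_distrib mult_right_mono flip: mult.assoc)
    qed (intro summable_on_cmult_right ell2_summable L.lift_form(1) R.lift_form(1) f)+
    finally have "gap G T p q a b * (I * ell2_inner (verts T) (R.lift f) (R.lift f))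
        \<le> gap G T p q a b * ell2_inner (verts T) (L.lift f) (L.lift f)"
      by (rule mult_left_mono) (rule L.gap_nonneg)
    also have "\<dots> \<le> L.energy f" by (rule L.gap_lower[OF f])
    also have "\<dots> \<le> (\<Sum>\<^sub>\<infinity>e\<in>arcs T. S * (R.weight (q e) * (cmod (f (head T e) - f (tail T e)))\<^sup>2)) / 2"
      unfolding L.energy_def
    proof (intro divide_right_mono infsum_mono)
      fix e assume e: "e \<in> arcs T"
      have "L.weight (q e) \<le> S * R.weight (q e)"
        using S[OF L.arc_map(1)[OF e]] R.weight_pos[OF R.arc_map(1)[OF e]] by (simp add: pos_divide_le_eq)
      then show "L.weight (q e) * (cmod (f (head T e) - f (tail T e)))\<^sup>2
          \<le> S * (R.weight (q e) * (cmod (f (head T e) - f (tail T e)))\<^sup>2)"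
        by (simp add: mult_right_mono flip: mult.assoc)
    qed (intro summable_on_cmult_right L.lift_form(2) R.lift_form(2) f | simp)+
    also have "\<dots> = S * R.energy f"
      by (simp add: R.energy_def infsum_cmult_right')
    finally show "I / S * gap G T p q a b * ell2_inner (verts T) (R.lift f) (R.lift f) \<le> R.energy f"
      using S_pos by (simp add: pos_divide_le_eq mult_ac)
  qed
  then show "gap G T p q a b \<le> S / I * gap G T p q a' b'"
    using S_pos I_pos by (simp add: field_simps)
qed

theorem theorem2p2:
  fixes G :: "('v, 'e) pre_digraph" and arevG :: "'e \<Rightarrow> 'e"
    and T :: "('w, 'f) pre_digraph" and arevT :: "'f \<Rightarrow> 'f"
    and p :: "'w \<Rightarrow> 'v" and q :: "'f \<Rightarrow> 'e"
    and a a' :: "'e \<Rightarrow> real" and b b' :: "'v \<Rightarrow> real" and \<psi> \<psi>' :: "'v \<Rightarrow> real"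
    and S S' I I' :: real
  assumes "finite_leafless_graph G arevG"
    and "universal_cover T arevT G arevG p q"
    and "jacobi_parameters G arevG a b"
    and "jacobi_parameters G arevG a' b'"
    and "perron_eigenvector G a b \<psi>"
    and "perron_eigenvector G a' b' \<psi>'"
    and "S = (SUP e \<in> arcs G. a e / a' e *
           (\<psi> (tail G e) * \<psi> (head G e) / (\<psi>' (tail G e) * \<psi>' (head G e))))"
    and "S' = (SUP e \<in> arcs G. a' e / a e *
           (\<psi>' (tail G e) * \<psi>' (head G e) / (\<psi> (tail G e) * \<psi> (head G e))))"
    and "I = (INF j \<in> verts G. (\<psi> j)\<^sup>2 / (\<psi>' j)\<^sup>2)"
    and "I' = (INF j \<in> verts G. (\<psi>' j)\<^sup>2 / (\<psi> j)\<^sup>2)"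
  shows "I' / S' * gap G T p q a' b' \<le> gap G T p q a b
       \<and> gap G T p q a b \<le> S / I * gap G T p q a' b'"
proof -
  have L: "perron_cover G arevG T arevT p q a b \<psi>"
    and R: "perron_cover G arevG T arevT p q a' b' \<psi>'"
    using assms(1-6) by (auto intro: perron_cover.intro)
  note upper = gap_comparison[OF L R, folded assms(7) assms(9)]
  \<comment> \<open>With the roles exchanged the upper estimate bounds the second gap by
    \<open>S' / I'\<close> times the first; division by this positive factor gives the left
    inequality.\<close>
  note lower = gap_comparison[OF R L, folded assms(8) assms(10)]
  have "I' / S' * gap G T p q a' b' \<le> gap G T p q a b"
    using lower by (simp add: field_simps)
  with upper(3) show ?thesis by simp
qed

end
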